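(* Let $M=\{x\in\mathbb{R}^2 : 1\le |x|\le 2\}$, let $S=C^1(M)$ (real-valued functions), and consider the 2D Euler equation in vorticity form on $M$ with given circulation $\sigma_1\in\mathbb{R}$ along the inner boundary (as specified in the context). There exist a $\xi\in S$, $\epsilon>0$ and $T>0$ such that for any initial condition $\omega(0)\in S$ satisfying $\|\omega(0)-\xi\|_{C^1}<\epsilon$, the corresponding solution $\omega(t)$ of the 2D Euler equation satisfies $\|\omega(t)-\xi\|_{C^1}>\epsilon$ for all $t>T$.
   Context: $M=\{x\in\mathbb{R}^2 : 1\le|x|\le 2\}$ is the closed annulus, with inner boundary $\Gamma_1=\{|x|=1\}$ and outer boundary $\Gamma_2=\{|x|=2\}$, so $\partial M=\Gamma_1\cup\Gamma_2$; $n$ denotes the unit normal to $\partial M$. The space $S=\{\omega : \omega\in C^1(M)\}$ consists of real-valued functions continuously differentiable on $M$ (up to the boundary), with the usual norm $\|\omega\|_{C^1}=\sup_M|\omega|+\sup_M|\nabla\omega|$. The 2D Euler equation of inviscid incompressible fluids on $M$ in vorticity form, with given circulation $\sigma_1\in\mathbb{R}$, for the scalar vorticity $\omega=\omega(t,x)$ and velocity field $u=u(t,x)\in\mathbb{R}^2$, is $$\partial_t\omega+u\cdot\nabla\omega=0,\qquad \omega=\operatorname{curl}u=\partial_{x_1}u_2-\partial_{x_2}u_1,\qquad \nabla\cdot u=0 \quad\text{in } M,$$ $$u\cdot n=0\ \text{ on }\partial M=\Gamma_1\cup\Gamma_2,\qquad \int_{\Gamma_1}u\cdot dl=\sigma_1,\qquad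 u(0,x)=u^0(x),$$ where $\Gamma_1$ is oriented counterclockwise. At each time, $u(t,\cdot)$ is determined uniquely by $\omega(t,\cdot)$ and $\sigma_1$ through the conditions $\operatorname{curl}u=\omega$, $\nabla\cdot u=0$, $u\cdot n=0$ on $\partial M$, $\int_{\Gamma_1}u\cdot dl=\sigma_1$; in particular, the initial velocity $u^0$ is determined by $\omega(0)$ and $\sigma_1$. It is a known fact that for any $\omega^0\in S$ there is a unique solution $\omega(t)\in S$ of this system for all $t\in\mathbb{R}$ with $\omega(0)=\omega^0$, and it is a classical solution (the equations hold for all $t$ and $x$). "The corresponding solution" refers to this solution. *)

theory Defs
  imports "HOL-Analysis.Analysis"
begin

definition annulus :: "(real^2) set" where
  "annulus = {x. 1 \<le> norm x \<and> norm x \<le> 2}"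

text \<open>
  Spatial derivatives are total derivatives taken within the closed annulus, so that they make
  sense up to the boundary: at every point of the annulus a derivative within the annulus is
  unique, and at interior points it is the ordinary one. Functions on the annulus are represented
  by total functions whose values outside of the annulus are irrelevant.
\<close>

definition pd :: "2 \<Rightarrow> (real^2 \<Rightarrow> real) \<Rightarrow> real^2 \<Rightarrow> real" where
  "pd i f x = frechet_derivative f (at x within annulus) (axis i 1)"

definition grad :: "(real^2 \<Rightarrow> real) \<Rightarrow> real^2 \<Rightarrow> real^2" where
  "grad f x = (\<chi> i. pd i f x)"

definition curl :: "(real^2 \<Rightarrow> real^2) \<Rightarrow> real^2 \<Rightarrow> real" where
  "curl v x = pd 1 (\<lambda>y. v y $ 2) x - pd 2 (\<lambda>y. v y $ 1) x"

definition divergence :: "(real^2 \<Rightarrow> real^2) \<Rightarrow> real^2 \<Rightarrow> real" where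
  "divergence v x = (\<Sum>i\<in>UNIV. pd i (\<lambda>y. v y $ i) x)"

definition C1_annulus :: "(real^2 \<Rightarrow> real) set" where
  "C1_annulus = {f. f differentiable_on annulus \<and> continuous_on annulus (grad f)}"

definition C1_norm :: "(real^2 \<Rightarrow> real) \<Rightarrow> real" where
  "C1_norm f = (SUP x\<in>annulus. \<bar>f x\<bar>) + (SUP x\<in>annulus. norm (grad f x))"

text \<open>
  Curves in the space of continuously differentiable functions on the annulus that are continuous
  in time: the function and its gradient are jointly continuous in time and space. As the annulus
  is compact, this is the same as continuity of the curve with respect to the norm above.
\<close>

definition C1_curve :: "(real \<Rightarrow> real^2 \<Rightarrow> real) \<Rightarrow> bool" where
  "C1_curve f \<longleftrightarrow>
     (\<forall>t. f t \<in> C1_annulus) \<and>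
     continuous_on (UNIV \<times> annulus) (\<lambda>(t, x). f t x) \<and>
     continuous_on (UNIV \<times> annulus) (\<lambda>(t, x). grad (f t) x)"

text \<open>Outward unit normal, meaningful only on the two boundary circles.\<close>

definition unit_normal :: "real^2 \<Rightarrow> real^2" where
  "unit_normal x = (if norm x = 1 then - x else (1 / norm x) *\<^sub>R x)"

text \<open>The inner circle, parametrised counterclockwise.\<close>

definition inner_circle :: "real \<Rightarrow> real^2" where
  "inner_circle \<theta> = vector [cos \<theta>, sin \<theta>]"

definition inner_circulation :: "(real^2 \<Rightarrow> real^2) \<Rightarrow> real" where
  "inner_circulation v =
     integral {0..2 * pi}
       (\<lambda>\<theta>. v (inner_circle \<theta>) \<bullet> vector_derivative inner_circle (at \<theta>))"

text \<open>
  Global classical solutions with circulation \<open>\<sigma>\<close> and initial vorticity \<open>\<omega>0\<close>: the vorticity, the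
  velocity and all their derivatives entering the equations are continuous in time and space
  (for the time derivative of the vorticity this follows from the transport equation). The
  initial velocity is not prescribed separately, as it is determined by \<open>\<omega>0\<close> and \<open>\<sigma>\<close>.
\<close>

definition euler_solution ::
  "real \<Rightarrow> (real^2 \<Rightarrow> real) \<Rightarrow> (real \<Rightarrow> real^2 \<Rightarrow> real) \<Rightarrow> (real \<Rightarrow> real^2 \<Rightarrow> real^2) \<Rightarrow> bool" where
  "euler_solution \<sigma> \<omega>0 \<omega> u \<longleftrightarrow>
     C1_curve \<omega> \<and> (\<forall>i. C1_curve (\<lambda>t x. u t x $ i)) \<and>
     (\<forall>t. \<forall>x\<in>annulus.
        ((\<lambda>s. \<omega> s x) has_real_derivative - (u t x \<bullet> grad (\<omega> t) x)) (at t) \<and>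
        \<omega> t x = curl (u t) x \<and>
        divergence (u t) x = 0) \<and>
     (\<forall>t x. norm x = 1 \<or> norm x = 2 \<longrightarrow> u t x \<bullet> unit_normal x = 0) \<and>
     (\<forall>t. inner_circulation (u t) = \<sigma>) \<and>
     (\<forall>x\<in>annulus. \<omega> 0 x = \<omega>0 x)"

end

theory Submission
  imports Defs
begin

text \<open>
  Take \<open>\<xi> = c + cos \<theta> / 2\<close>, where the constant \<open>c\<close> is such that the steady flow with vorticity
  \<open>c\<close> and circulation \<open>\<sigma>1\<close> rotates the two boundary circles at different angular velocities. The
  vorticity is transported, so it stays within distance \<open>1\<close> of \<open>c\<close> for all times; comparing the
  stream function with radial barriers, the maximum principle then keeps the angular velocities on
  the two circles apart by a fixed amount. Hence the particles that form the radial segment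
  \<open>\<theta> = 0\<close> at a late time \<open>t\<close> come from a curve that joined the two circles and wound around the
  annulus at least twice. Along this curve the initial vorticity oscillates, so the vorticity at time
  \<open>t\<close> does so along half of the segment, and its radial derivative is large somewhere.
\<close>

text \<open>The obstacle is that later vorticities are controlled in the sup norm only, since their
  gradients may grow: the shear has to come out of \<open>\<bar>\<omega> t x - c\<bar> < 1\<close>
  alone. It is measured on the two circles because these are invariant, so the ends of the
  transported curve slide along them whatever the flow does in between. The stream function is
  constant on each circle, but the difference of the two constants, the flux between the circles, is
  not among the data and may vary in time. The barriers therefore contain it as an unknown, and the
  prescribed inner circulation pins it down up to a multiple of the deviation of the vorticity from
  c. A constant c of the right size outweighs these errors for every \<sigma>1. The profile \<xi>
  depends on the angle, so that winding becomes visible, and is constant on rays, so that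
  subtracting it cannot hide a radial oscillation of \<omega>.\<close>

section \<open>Differential calculus within the closed annulus\<close>

lemma compact_annulus: "compact annulus"
proof -
  have "annulus = cball 0 2 - ball 0 1" by (auto simp: annulus_def)
  then show ?thesis by (metis compact_diff compact_cball open_ball)
qed

text \<open>Along the ray the squared norm changes by h (2 x.v + h v.v). On a boundary circle the
  sign of x.v decides for small h; away from the circles continuity is enough.\<close>

lemma eventually_ray_in_annulus:
  assumes x: "x \<in> annulus"
    and v: "norm x = 1 \<Longrightarrow> 0 < x \<bullet> v" "norm x = 2 \<Longrightarrow> x \<bullet> v < 0"
  shows "\<forall>\<^sub>F h in at_right 0. x + h *\<^sub>R v \<in> annulus"
proof -
  have sq: "(norm (x + h *\<^sub>R v))\<^sup>2 = (norm x)\<^sup>2 + h * (2 * (x \<bullet> v) + h * (v \<bullet> v))" for h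
    by (simp add: power2_norm_eq_inner inner_add_left inner_add_right inner_commute algebra_simps)
  have lim: "((\<lambda>h. 2 * (x \<bullet> v) + h * (v \<bullet> v)) \<longlongrightarrow> 2 * (x \<bullet> v) + 0 * (v \<bullet> v)) (at_right 0)"
    by (intro tendsto_intros)
  have lim': "((\<lambda>h. norm (x + h *\<^sub>R v)) \<longlongrightarrow> norm (x + 0 *\<^sub>R v)) (at_right 0)"
    by (intro tendsto_intros)
  have pos: "\<forall>\<^sub>F h::real in at_right 0. 0 < h" by (simp add: eventually_at_right_less)
  have low: "\<forall>\<^sub>F h in at_right 0. 1 \<le> norm (x + h *\<^sub>R v)"
  proof (cases "norm x = 1")
    case True
    have "\<forall>\<^sub>F h in at_right 0. 0 < 2 * (x \<bullet> v) + h * (v \<bullet> v)"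
      using order_tendstoD(1)[OF lim, of 0] v(1)[OF True] by simp
    with pos show ?thesis
    proof eventually_elim
      case (elim h)
      then have "1\<^sup>2 \<le> (norm (x + h *\<^sub>R v))\<^sup>2" unfolding sq using True by simp
      then show ?case by (rule power2_le_imp_le) simp
    qed
  next
    case False
    then have "1 < norm x" using x by (auto simp: annulus_def)
    then show ?thesis using order_tendstoD(1)[OF lim', of 1] by (auto elim: eventually_mono)
  qed
  have up: "\<forall>\<^sub>F h in at_right 0. norm (x + h *\<^sub>R v) \<le> 2"
  proof (cases "norm x = 2")
    case True
    have "\<forall>\<^sub>F h in at_right 0. 2 * (x \<bullet> v) + h * (v \<bullet> v) < 0"
      using order_tendstoD(2)[OF lim, of 0] v(2)[OF True] by simp
    with pos show ?thesis
    proof eventually_elim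
      case (elim h)
      then have "h * (2 * (x \<bullet> v) + h * (v \<bullet> v)) \<le> 0" by (simp add: mult_nonneg_nonpos)
      then have "(norm (x + h *\<^sub>R v))\<^sup>2 \<le> 2\<^sup>2" unfolding sq using True by simp
      then show ?case by (rule power2_le_imp_le) simp
    qed
  next
    case False
    then have "norm x < 2" using x by (auto simp: annulus_def)
    then show ?thesis using order_tendstoD(2)[OF lim', of 2] by (auto elim: eventually_mono)
  qed
  from low up show ?thesis by eventually_elim (simp add: annulus_def)
qed

text \<open>At a boundary point a derivative can be tested only along directions pointing into the
  annulus. These fill an open half plane, so every vector is a combination of two of them, and
  linearity does the rest. Uniqueness is what makes the choice in \<open>frechet_derivative\<close>
  harmless.\<close>

lemma has_derivative_annulus_unique:
  fixes f :: "real^2 \<Rightarrow> real"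
  assumes x: "x \<in> annulus"
    and D: "(f has_derivative D) (at x within annulus)"
    and E: "(f has_derivative E) (at x within annulus)"
  shows "D = E"
proof -
  interpret D: bounded_linear D using D by (rule has_derivative_bounded_linear)
  interpret E: bounded_linear E using E by (rule has_derivative_bounded_linear)
  have agree: "D v = E v"
    if v: "norm x = 1 \<Longrightarrow> 0 < x \<bullet> v" "norm x = 2 \<Longrightarrow> x \<bullet> v < 0" for v
  proof -
    obtain d where d: "d > 0" and in_annulus: "\<And>h. 0 < h \<Longrightarrow> h < d \<Longrightarrow> x + h *\<^sub>R v \<in> annulus"
      using eventually_ray_in_annulus[OF x v] by (auto simp: eventually_at_right_field)
    have path: "(\<lambda>h. x + h *\<^sub>R v) \<in> {0..<d} \<rightarrow> annulus"
    proof
      fix h assume "h \<in> {0..<d}"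
      then show "x + h *\<^sub>R v \<in> annulus" using in_annulus[of h] x by (cases "h = 0") auto
    qed
    have vec: "((\<lambda>h. f (x + h *\<^sub>R v)) has_vector_derivative F v) (at 0 within {0..<d})"
      if F: "(f has_derivative F) (at x within annulus)" for F
    proof -
      have "((\<lambda>h. x + h *\<^sub>R v) has_vector_derivative v) (at 0 within {0..<d})"
        by (auto intro!: derivative_eq_intros)
      moreover have "(f has_derivative F) (at (x + 0 *\<^sub>R v) within (\<lambda>h. x + h *\<^sub>R v) ` {0..<d})"
        using has_derivative_subset[OF F, of "(\<lambda>h. x + h *\<^sub>R v) ` {0..<d}"] path by auto
      ultimately show ?thesis
        using vector_derivative_diff_chain_within by (force simp: o_def)
    qed
    have nt: "at (0::real) within {0..<d} \<noteq> bot"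
      using d by (simp add: trivial_limit_within islimpt_Ico)
    show ?thesis
      using vector_derivative_unique_within[OF nt vec[OF D] vec[OF E]] .
  qed
  show ?thesis
  proof
    fix w :: "real^2"
    \<comment> \<open>The vector s x points radially into the annulus on either circle, and K is
      large enough for adding K s x to turn w inwards too.\<close>
    define s :: real where "s = (if norm x = 2 then - 1 else 1)"
    define K where "K = norm w + 1"
    have xw: "\<bar>x \<bullet> w\<bar> \<le> norm x * norm w" by (rule Cauchy_Schwarz_ineq2)
    have "D (w + (K * s) *\<^sub>R x) = E (w + (K * s) *\<^sub>R x)"
    proof (rule agree)
      show "0 < x \<bullet> (w + (K * s) *\<^sub>R x)" if "norm x = 1"
        using xw that by (simp add: s_def K_def inner_add_right flip: power2_norm_eq_inner)
      show "x \<bullet> (w + (K * s) *\<^sub>R x) < 0" if "norm x = 2"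
        using xw that norm_ge_zero[of w]
        by (simp add: s_def K_def inner_add_right abs_le_iff flip: power2_norm_eq_inner)
    qed
    moreover have "D (s *\<^sub>R x) = E (s *\<^sub>R x)"
      by (rule agree) (simp_all add: s_def flip: power2_norm_eq_inner)
    ultimately show "D w = E w"
      by (simp add: D.add E.add D.scaleR E.scaleR s_def split: if_splits)
  qed
qed

lemma C1_annulus_has_derivative:
  assumes "f \<in> C1_annulus" "x \<in> annulus"
  shows "(f has_derivative (\<lambda>v. grad f x \<bullet> v)) (at x within annulus)"
proof -
  let ?D = "frechet_derivative f (at x within annulus)"
  have D: "(f has_derivative ?D) (at x within annulus)"
    using assms by (simp add: C1_annulus_def differentiable_on_def flip: frechet_derivative_works)
  then interpret bounded_linear ?D by (rule has_derivative_bounded_linear)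
  have "?D v = grad f x \<bullet> v" for v
  proof -
    have "v = v $ 1 *\<^sub>R axis 1 1 + v $ 2 *\<^sub>R axis 2 1"
      by (simp add: vec_eq_iff axis_def forall_2)
    then have "?D v = v $ 1 * ?D (axis 1 1) + v $ 2 * ?D (axis 2 1)"
      by (metis add scaleR real_scaleR_def)
    then show ?thesis by (simp add: inner_vec_def sum_2 grad_def pd_def)
  qed
  then show ?thesis using D by presburger
qed

lemma grad_eqI:
  assumes "x \<in> annulus" "(f has_derivative (\<lambda>v. G \<bullet> v)) (at x within annulus)"
  shows "grad f x = G"
proof -
  have "(f has_derivative frechet_derivative f (at x within annulus)) (at x within annulus)"
    using assms(2) differentiable_def frechet_derivative_works by blast
  from has_derivative_annulus_unique[OF assms(1) this assms(2)] show ?thesis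
    by (simp add: grad_def pd_def vec_eq_iff inner_axis)
qed

lemma C1_annulusI:
  assumes "\<And>x. x \<in> annulus \<Longrightarrow> (f has_derivative (\<lambda>v. G x \<bullet> v)) (at x within annulus)"
    and "continuous_on annulus G"
  shows "f \<in> C1_annulus"
proof -
  have "continuous_on annulus (grad f)"
    using assms by (subst continuous_on_cong[OF refl grad_eqI]) auto
  then show ?thesis
    using assms(1) by (auto simp: C1_annulus_def differentiable_on_def differentiable_def)
qed

lemma C1_annulus_diff:
  assumes "f \<in> C1_annulus" "g \<in> C1_annulus"
  shows "(\<lambda>x. f x - g x) \<in> C1_annulus"
proof (rule C1_annulusI)
  show "((\<lambda>x. f x - g x) has_derivative (\<lambda>v. (grad f x - grad g x) \<bullet> v)) (at x within annulus)"
    if "x \<in> annulus" for x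
    unfolding inner_diff_left
    by (intro has_derivative_diff C1_annulus_has_derivative assms that)
  show "continuous_on annulus (\<lambda>x. grad f x - grad g x)"
    using assms by (intro continuous_on_diff) (auto simp: C1_annulus_def)
qed

text \<open>The real supremum is meaningful only for sets that are bounded above; compactness of the
  annulus provides this for both suprema.\<close>

lemma C1_norm_bounds:
  assumes f: "f \<in> C1_annulus" and x: "x \<in> annulus"
  shows "\<bar>f x\<bar> \<le> C1_norm f" "norm (grad f x) \<le> C1_norm f"
proof -
  have "continuous_on annulus (\<lambda>x. \<bar>f x\<bar>)" "continuous_on annulus (\<lambda>x. norm (grad f x))"
    using f differentiable_imp_continuous_on[of f annulus]
    by (auto simp: C1_annulus_def intro!: continuous_on_rabs continuous_on_norm)
  then have "bdd_above ((\<lambda>x. \<bar>f x\<bar>) ` annulus)" "bdd_above ((\<lambda>x. norm (grad f x)) ` annulus)"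
    by (simp_all add: compact_annulus compact_continuous_image compact_imp_bounded bounded_imp_bdd_above)
  then have "\<bar>f x\<bar> \<le> (SUP x\<in>annulus. \<bar>f x\<bar>)" "norm (grad f x) \<le> (SUP x\<in>annulus. norm (grad f x))"
    using x by (auto intro: cSUP_upper)
  then show "\<bar>f x\<bar> \<le> C1_norm f" "norm (grad f x) \<le> C1_norm f"
    unfolding C1_norm_def using abs_ge_zero[of "f x"] norm_ge_zero[of "grad f x"] by linarith+
qed

section \<open>Polar coordinates\<close>

text \<open>The lifted polar coordinates are \<open>(r, \<theta>) \<mapsto> r *\<^sub>R inner_circle \<theta>\<close>.\<close>

definition tangent :: "real \<Rightarrow> real^2" where
  "tangent \<theta> = vector [- sin \<theta>, cos \<theta>]"

lemma norm_inner_circle [simp]: "norm (inner_circle \<theta>) = 1"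
  by (simp add: inner_circle_def norm_vec_def L2_set_def sum_2)

lemma polar_in_annulus [simp]: "r \<in> {1..2} \<Longrightarrow> r *\<^sub>R inner_circle \<theta> \<in> annulus"
  by (simp add: annulus_def)

lemma inner_circle_eq: "inner_circle \<theta> = cos \<theta> *\<^sub>R axis 1 1 + sin \<theta> *\<^sub>R axis 2 1"
  by (auto simp: inner_circle_def vec_eq_iff forall_2 axis_def)

lemma tangent_eq: "tangent \<theta> = cos \<theta> *\<^sub>R axis 2 1 - sin \<theta> *\<^sub>R axis 1 1"
  by (auto simp: tangent_def vec_eq_iff forall_2 axis_def)

lemma inner_circle_has_vector_derivative:
  "(inner_circle has_vector_derivative tangent \<theta>) (at \<theta> within S)"
  unfolding inner_circle_eq[abs_def] tangent_eq
  by (auto intro!: derivative_eq_intros has_field_derivative_subset[OF DERIV_sin] has_field_derivative_subset[OF DERIV_cos])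

lemma continuous_on_inner_circle [continuous_intros]:
  fixes f :: "'a::t2_space \<Rightarrow> real"
  shows "continuous_on S f \<Longrightarrow> continuous_on S (\<lambda>x. inner_circle (f x))"
  unfolding inner_circle_eq
  by (intro continuous_intros continuous_on_cos continuous_on_sin)

lemma continuous_on_tangent [continuous_intros]:
  fixes f :: "'a::t2_space \<Rightarrow> real"
  shows "continuous_on S f \<Longrightarrow> continuous_on S (\<lambda>x. tangent (f x))"
  unfolding tangent_eq
  by (intro continuous_intros continuous_on_cos continuous_on_sin)

lemma inner_circle_period [simp]: "inner_circle (\<theta> + 2 * pi * of_int n) = inner_circle \<theta>"
  by (simp add: inner_circle_eq sin_add cos_add)

lemma polar_has_derivative_radius:
  assumes "f \<in> C1_annulus" "r \<in> {1..2}"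
  shows "((\<lambda>r. f (r *\<^sub>R inner_circle \<theta>)) has_real_derivative
          grad f (r *\<^sub>R inner_circle \<theta>) \<bullet> inner_circle \<theta>) (at r within {1..2})"
proof -
  have "((\<lambda>r. r *\<^sub>R inner_circle \<theta>) has_vector_derivative inner_circle \<theta>) (at r within {1..2})"
    by (auto intro!: derivative_eq_intros)
  moreover have "(f has_derivative (\<lambda>v. grad f (r *\<^sub>R inner_circle \<theta>) \<bullet> v))
      (at (r *\<^sub>R inner_circle \<theta>) within (\<lambda>r. r *\<^sub>R inner_circle \<theta>) ` {1..2})"
    by (rule has_derivative_subset[OF C1_annulus_has_derivative[OF assms(1)]]) (use assms(2) in auto)
  ultimately show ?thesis
    using vector_derivative_diff_chain_within
    by (force simp: o_def has_real_derivative_iff_has_vector_derivative)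
qed

text \<open>Circles with radius in [1, 2] stay inside the annulus, so the angular derivative is
  two-sided even on the boundary, unlike the radial one.\<close>

lemma polar_has_derivative_angle:
  assumes "f \<in> C1_annulus" "r \<in> {1..2}"
  shows "((\<lambda>\<theta>. f (r *\<^sub>R inner_circle \<theta>)) has_real_derivative
          r * (grad f (r *\<^sub>R inner_circle \<theta>) \<bullet> tangent \<theta>)) (at \<theta>)"
proof -
  have "((\<lambda>\<theta>. r *\<^sub>R inner_circle \<theta>) has_vector_derivative r *\<^sub>R tangent \<theta>) (at \<theta>)"
    by (auto intro!: derivative_eq_intros inner_circle_has_vector_derivative)
  moreover have "(f has_derivative (\<lambda>v. grad f (r *\<^sub>R inner_circle \<theta>) \<bullet> v))
      (at (r *\<^sub>R inner_circle \<theta>) within (\<lambda>\<theta>. r *\<^sub>R inner_circle \<theta>) ` UNIV)"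
    by (rule has_derivative_subset[OF C1_annulus_has_derivative[OF assms(1)]]) (use assms(2) in auto)
  ultimately show ?thesis
    using vector_derivative_diff_chain_within[of "\<lambda>\<theta>. r *\<^sub>R inner_circle \<theta>" _ \<theta> UNIV]
    by (force simp: o_def has_real_derivative_iff_has_vector_derivative)
qed

section \<open>A maximum principle in polar coordinates\<close>

text \<open>If f'' were positive, f' would be positive just to the right of its zero x, and f would
  increase there. Differentiability of f' at the single point x suffices for this.\<close>

lemma second_derivative_at_max:
  fixes f f' :: "real \<Rightarrow> real"
  assumes d: "0 < d" and max: "\<And>y. \<bar>x - y\<bar> < d \<Longrightarrow> f y \<le> f x"
    and f': "\<And>y. \<bar>x - y\<bar> < d \<Longrightarrow> (f has_real_derivative f' y) (at y)"
    and f'': "(f' has_real_derivative f'') (at x)"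
  shows "f' x = 0" "f'' \<le> 0"
proof -
  show *: "f' x = 0" using DERIV_local_max[of f "f' x" x d] f'[of x] d max by auto
  show "f'' \<le> 0"
  proof (rule ccontr)
    assume "\<not> f'' \<le> 0"
    then obtain e where e: "e > 0" "\<And>h. 0 < h \<Longrightarrow> h < e \<Longrightarrow> f' x < f' (x + h)"
      using DERIV_pos_inc_right[OF f''] by auto
    define h where "h = min d e / 2"
    have h: "0 < h" "h < d" "h < e" using d e by (auto simp: h_def)
    have "f x < f (x + h)"
    proof (rule DERIV_pos_imp_increasing_open[of x "x + h" f])
      fix z assume "x < z" "z < x + h"
      then show "\<exists>y. (f has_real_derivative y) (at z) \<and> y > 0"
        using f'[of z] e(2)[of "z - x"] * h by auto
    next
      show "continuous_on {x..x + h} f"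
        using DERIV_isCont[OF f'] h by (intro continuous_at_imp_continuous_on ballI) auto
    qed (use h in simp)
    with max[of "x + h"] h show False by simp
  qed
qed

text \<open>The quantity in \<open>laplacian\<close> is the Laplacian in polar coordinates. As it is
  strictly positive, the second derivative test in r and in \<theta> separately excludes an interior
  maximum; no mixed derivatives enter. Periodicity reduces the unbounded strip to a compact
  rectangle.\<close>

lemma polar_max_principle:
  fixes \<phi> \<phi>r \<phi>t \<phi>rr \<phi>tt :: "real \<Rightarrow> real \<Rightarrow> real"
  assumes periodic: "\<And>r \<theta> n. \<phi> r (\<theta> + 2 * pi * of_int n) = \<phi> r \<theta>"
    and cont: "continuous_on ({1..2} \<times> UNIV) (\<lambda>(r, \<theta>). \<phi> r \<theta>)"
    and r: "\<And>r \<theta>. 1 < r \<Longrightarrow> r < 2 \<Longrightarrow> ((\<lambda>r. \<phi> r \<theta>) has_real_derivative \<phi>r r \<theta>) (at r)"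
    and rr: "\<And>r \<theta>. 1 < r \<Longrightarrow> r < 2 \<Longrightarrow> ((\<lambda>r. \<phi>r r \<theta>) has_real_derivative \<phi>rr r \<theta>) (at r)"
    and t: "\<And>r \<theta>. 1 < r \<Longrightarrow> r < 2 \<Longrightarrow> (\<phi> r has_real_derivative \<phi>t r \<theta>) (at \<theta>)"
    and tt: "\<And>r \<theta>. 1 < r \<Longrightarrow> r < 2 \<Longrightarrow> (\<phi>t r has_real_derivative \<phi>tt r \<theta>) (at \<theta>)"
    and laplacian: "\<And>r \<theta>. 1 < r \<Longrightarrow> r < 2 \<Longrightarrow> 0 < \<phi>rr r \<theta> + \<phi>r r \<theta> / r + \<phi>tt r \<theta> / r\<^sup>2"
    and boundary: "\<And>\<theta>. \<phi> 1 \<theta> \<le> 0" "\<And>\<theta>. \<phi> 2 \<theta> \<le> 0"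
    and r': "r' \<in> {1..2}"
  shows "\<phi> r' \<theta>' \<le> 0"
proof -
  let ?K = "{1..2::real} \<times> {0..2 * pi}"
  have "compact ?K" by (intro compact_Times compact_Icc)
  moreover have "continuous_on ?K (\<lambda>(r, \<theta>). \<phi> r \<theta>)"
    by (rule continuous_on_subset[OF cont]) auto
  moreover have "(1, 0) \<in> ?K" by simp
  ultimately obtain p where p: "p \<in> ?K" "\<And>q. q \<in> ?K \<Longrightarrow> (\<lambda>(r, \<theta>). \<phi> r \<theta>) q \<le> (\<lambda>(r, \<theta>). \<phi> r \<theta>) p"
    using continuous_attains_sup[of ?K "\<lambda>(r, \<theta>). \<phi> r \<theta>"] by blast
  obtain r0 \<theta>0 where p_eq: "p = (r0, \<theta>0)" by force
  have r0: "r0 \<in> {1..2}" using p p_eq by simp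
  have max: "\<phi> r \<theta> \<le> \<phi> r0 \<theta>0" if "r \<in> {1..2}" for r \<theta>
  proof -
    define n where "n = \<lfloor>\<theta> / (2 * pi)\<rfloor>"
    have "of_int n \<le> \<theta> / (2 * pi)" "\<theta> / (2 * pi) \<le> of_int n + 1" unfolding n_def by linarith+
    then have "\<theta> - 2 * pi * of_int n \<in> {0..2 * pi}"
      by (simp add: pos_le_divide_eq pos_divide_le_eq algebra_simps)
    then have "\<phi> r (\<theta> - 2 * pi * of_int n) \<le> \<phi> r0 \<theta>0"
      using p(2)[of "(r, \<theta> - 2 * pi * of_int n)"] that p_eq by simp
    then show ?thesis using periodic[of r \<theta> "- n"] by simp
  qed
  have "\<phi> r0 \<theta>0 \<le> 0"
  proof (rule ccontr)
    assume pos: "\<not> \<phi> r0 \<theta>0 \<le> 0"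
    then have "r0 \<noteq> 1" "r0 \<noteq> 2" using boundary by auto
    then have r0': "1 < r0" "r0 < 2" using r0 by auto
    define d where "d = min (r0 - 1) (2 - r0)"
    have d: "0 < d" using r0' by (simp add: d_def)
    have near: "1 < y \<and> y < 2" if "\<bar>r0 - y\<bar> < d" for y
      using that by (auto simp: d_def)
    have r_max: "\<phi> y \<theta>0 \<le> \<phi> r0 \<theta>0" if "\<bar>r0 - y\<bar> < d" for y
      using near[OF that] by (intro max) auto
    have r_deriv: "((\<lambda>r. \<phi> r \<theta>0) has_real_derivative \<phi>r y \<theta>0) (at y)" if "\<bar>r0 - y\<bar> < d" for y
      using near[OF that] by (intro r) auto
    note r_test = second_derivative_at_max[of d r0 "\<lambda>r. \<phi> r \<theta>0" "\<lambda>r. \<phi>r r \<theta>0",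
        OF d r_max r_deriv rr[OF r0']]
    have "\<phi>tt r0 \<theta>0 \<le> 0"
      by (rule second_derivative_at_max(2)[of 1 \<theta>0 "\<phi> r0" "\<phi>t r0", OF _ max[OF r0] t[OF r0'] tt[OF r0']]) simp
    then have "\<phi>tt r0 \<theta>0 / r0\<^sup>2 \<le> 0" by (simp add: divide_nonpos_nonneg)
    with r_test show False using laplacian[OF r0', of \<theta>0] by simp
  qed
  with max[OF r', of \<theta>'] show ?thesis by simp
qed

text \<open>Separate continuity in r and \<theta> does not give joint continuity, but a Lipschitz
  bound in r that is uniform in \<theta> closes the gap. This is how the stream function meets the
  continuity hypothesis of the maximum principle.\<close>

lemma continuous_on_strip:
  fixes f f' :: "real \<Rightarrow> real \<Rightarrow> real"
  assumes deriv: "\<And>r \<theta>. r \<in> {a..b} \<Longrightarrow> ((\<lambda>r. f r \<theta>) has_real_derivative f' r \<theta>) (at r within {a..b})"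
    and bound: "\<And>r \<theta>. r \<in> {a..b} \<Longrightarrow> \<bar>f' r \<theta>\<bar> \<le> B"
    and slice: "\<And>r. r \<in> {a..b} \<Longrightarrow> continuous_on UNIV (f r)"
  shows "continuous_on ({a..b} \<times> UNIV) (\<lambda>(r, \<theta>). f r \<theta>)"
  unfolding continuous_on_def
proof clarify
  fix r \<theta> :: real assume r: "r \<in> {a..b}"
  let ?F = "at (r, \<theta>) within {a..b} \<times> UNIV"
  have lip: "\<bar>f r1 \<theta> - f r2 \<theta>\<bar> \<le> B * \<bar>r1 - r2\<bar>" if "r1 \<in> {a..b}" "r2 \<in> {a..b}" for r1 r2 \<theta>
    using field_differentiable_bound[of "{a..b}" "\<lambda>r. f r \<theta>" "\<lambda>r. f' r \<theta>" B r2 r1] deriv bound that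
    by (auto simp: abs_minus_commute)
  have 1: "((\<lambda>x. f (fst x) (snd x) - f r (snd x)) \<longlongrightarrow> 0) ?F"
  proof (rule tendsto_rabs_zero_cancel, rule tendsto_sandwich)
    show "\<forall>\<^sub>F x in ?F. 0 \<le> \<bar>f (fst x) (snd x) - f r (snd x)\<bar>" by simp
    show "\<forall>\<^sub>F x in ?F. \<bar>f (fst x) (snd x) - f r (snd x)\<bar> \<le> B * \<bar>fst x - r\<bar>"
      unfolding eventually_at_topological using lip r by auto
    have "((\<lambda>x. B * \<bar>fst x - r\<bar>) \<longlongrightarrow> B * \<bar>fst (r, \<theta>) - r\<bar>) ?F"
      by (intro tendsto_intros)
    then show "((\<lambda>x. B * \<bar>fst x - r\<bar>) \<longlongrightarrow> 0) ?F" by simp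
  qed simp
  have "continuous_on ({a..b} \<times> UNIV) (\<lambda>x. f r (snd x))"
    by (rule continuous_on_compose2[OF slice[OF r]]) (auto intro: continuous_intros)
  then have 2: "((\<lambda>x. f r (snd x)) \<longlongrightarrow> f r \<theta>) ?F"
    unfolding continuous_on_def using r by force
  from tendsto_add[OF 1 2] show "((\<lambda>(r, \<theta>). f r \<theta>) \<longlongrightarrow> f r \<theta>) ?F"
    by (simp add: case_prod_beta')
qed

section \<open>Approximate characteristics of a transport equation\<close>

text \<open>A mean value theorem for end points in either order and for derivatives that are
  one-sided at the ends of S; the two distance bounds serve to compare the intermediate point with
  either end.\<close>

lemma mvt_between:
  fixes f :: "real \<Rightarrow> real"
  assumes "convex S" "x \<in> S" "y \<in> S"
    and "\<And>z. z \<in> S \<Longrightarrow> (f has_real_derivative f' z) (at z within S)"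
  obtains z where "z \<in> S" "\<bar>z - x\<bar> \<le> \<bar>y - x\<bar>" "\<bar>z - y\<bar> \<le> \<bar>y - x\<bar>" "f y - f x = (y - x) * f' z"
proof -
  define u v where "u = min x y" and "v = max x y"
  have uv: "{u..v} \<subseteq> S"
    using closed_segment_subset[OF assms(2,3,1)] unfolding closed_segment_eq_real_ivl u_def v_def
    by (auto split: if_splits)
  have "\<exists>z\<in>{u..v}. f v - f u = (*) (f' z) (v - u)"
  proof (rule mvt_very_simple)
    show "(f has_derivative (*) (f' z)) (at z within {u..v})" if "u \<le> z" "z \<le> v" for z
    proof -
      have "z \<in> S" using uv that by auto
      from has_derivative_subset[OF assms(4)[OF this, unfolded has_field_derivative_def] uv]
      show ?thesis .
    qed
  qed (simp add: u_def v_def)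
  then obtain z where z: "z \<in> {u..v}" "f v - f u = f' z * (v - u)" by auto
  show thesis
  proof
    show "z \<in> S" using z uv by auto
    show "\<bar>z - x\<bar> \<le> \<bar>y - x\<bar>" "\<bar>z - y\<bar> \<le> \<bar>y - x\<bar>" using z by (auto simp: u_def v_def)
    show "f y - f x = (y - x) * f' z"
      using z(2) by (cases "x \<le> y") (auto simp: u_def v_def algebra_simps)
  qed
qed

lemma dist_triple_le:
  fixes x y z :: real
  shows "dist (x, y, z) (x', y', z') \<le> \<bar>x - x'\<bar> + \<bar>y - y'\<bar> + \<bar>z - z'\<bar>"
proof -
  have *: "dist (p, q) (p', q') \<le> dist p p' + dist q q'"
    for p p' :: "'a::metric_space" and q q' :: "'b::metric_space"
    using sqrt_sum_squares_le_sum_abs[of "dist p p'" "dist q q'"] by (simp add: dist_Pair_Pair)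
  show ?thesis
    using *[of x "(y, z)" x' "(y', z')"] *[of y z y' z'] by (simp add: dist_real_def)
qed

text \<open>
  Approximate characteristics of \<open>g\<^sub>t + a g\<^sub>r + b g\<^sub>\<theta> = 0\<close>, started on the ray of angle \<open>\<theta>0\<close> at time
  \<open>t\<close> and followed back to time \<open>0\<close> by explicit Euler steps. By uniform continuity a step of length
  \<open>h\<close> changes \<open>g\<close> by \<open>o(h)\<close> only, so no solution theory for ordinary differential equations is needed.
\<close>

lemma backward_characteristics:
  fixes a b p q g :: "real \<times> real \<times> real \<Rightarrow> real"
  assumes t: "0 < t" and \<eta>: "0 < \<eta>"
    and cont: "continuous_on ({0..t} \<times> {1..2} \<times> UNIV) a" "continuous_on ({0..t} \<times> {1..2} \<times> UNIV) b"
      "continuous_on ({0..t} \<times> {1..2} \<times> UNIV) p" "continuous_on ({0..t} \<times> {1..2} \<times> UNIV) q"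
    and gt: "\<And>\<tau> r \<theta>. \<tau> \<in> {0..t} \<Longrightarrow> r \<in> {1..2} \<Longrightarrow>
      ((\<lambda>\<tau>. g (\<tau>, r, \<theta>)) has_real_derivative
        - (a (\<tau>, r, \<theta>) * p (\<tau>, r, \<theta>) + b (\<tau>, r, \<theta>) * q (\<tau>, r, \<theta>))) (at \<tau>)"
    and gr: "\<And>\<tau> r \<theta>. \<tau> \<in> {0..t} \<Longrightarrow> r \<in> {1..2} \<Longrightarrow>
      ((\<lambda>r. g (\<tau>, r, \<theta>)) has_real_derivative p (\<tau>, r, \<theta>)) (at r within {1..2})"
    and g\<theta>: "\<And>\<tau> r \<theta>. \<tau> \<in> {0..t} \<Longrightarrow> r \<in> {1..2} \<Longrightarrow>
      ((\<lambda>\<theta>. g (\<tau>, r, \<theta>)) has_real_derivative q (\<tau>, r, \<theta>)) (at \<theta>)"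
    and a1: "\<And>\<tau> r \<theta>. \<tau> \<in> {0..t} \<Longrightarrow> r \<in> {1..2} \<Longrightarrow> \<bar>a (\<tau>, r, \<theta>)\<bar> \<le> C * (r - 1)"
    and a2: "\<And>\<tau> r \<theta>. \<tau> \<in> {0..t} \<Longrightarrow> r \<in> {1..2} \<Longrightarrow> \<bar>a (\<tau>, r, \<theta>)\<bar> \<le> C * (2 - r)"
    and b: "\<And>\<tau> r \<theta>. \<tau> \<in> {0..t} \<Longrightarrow> r \<in> {1..2} \<Longrightarrow> \<bar>b (\<tau>, r, \<theta>)\<bar> \<le> C"
    and m1: "\<And>\<tau> \<theta>. \<tau> \<in> {0..t} \<Longrightarrow> m1 \<le> b (\<tau>, 1, \<theta>)"
    and m2: "\<And>\<tau> \<theta>. \<tau> \<in> {0..t} \<Longrightarrow> b (\<tau>, 2, \<theta>) \<le> m2"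
  obtains R \<Theta> where "continuous_on {1..2} R" "continuous_on {1..2} \<Theta>"
    "\<And>r. r \<in> {1..2} \<Longrightarrow> R r \<in> {1..2}"
    "\<And>r. r \<in> {1..2} \<Longrightarrow> \<bar>g (0, R r, \<Theta> r) - g (t, r, \<theta>0)\<bar> \<le> \<eta>"
    "\<Theta> 1 \<le> \<theta>0 - t * m1" "\<theta>0 - t * m2 \<le> \<Theta> 2"
proof -
  have C: "0 \<le> C" using b[of 0 1 0] t by simp
  have a: "\<bar>a (\<tau>, r, \<theta>)\<bar> \<le> C" if "\<tau> \<in> {0..t}" "r \<in> {1..2}" for \<tau> r \<theta>
  proof -
    have "C * (r - 1) \<le> C * 1" using that C by (intro mult_left_mono) auto
    with a1[OF that, of \<theta>] show ?thesis by linarith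
  qed
  \<comment> \<open>Angles range over the whole line, but angular speed at most C confines the
    curves to this compact window, on which uniform continuity is available.\<close>
  define K where "K = {0..t} \<times> {1..2::real} \<times> {\<theta>0 - t * C..\<theta>0 + t * C}"
  have K: "K \<subseteq> {0..t} \<times> {1..2} \<times> UNIV" by (auto simp: K_def)
  \<comment> \<open>Each of the N steps of length h = t / N will cost at most 2 h \<eta>', hence all
    of them together 2 t \<eta>' = \<eta>.\<close>
  define \<eta>' where "\<eta>' = \<eta> / (2 * t)"
  have \<eta>': "0 < \<eta>'" using t \<eta> by (simp add: \<eta>'_def)
  \<comment> \<open>The mean value theorem is applied in each variable separately and yields
    different intermediate points, so the two factors must be allowed different arguments.\<close>
  have uniform: "\<exists>d>0. \<forall>x\<in>K. \<forall>y\<in>K. \<forall>z\<in>K. dist x y < d \<longrightarrow> dist x z < d \<longrightarrow> \<bar>u x * v x - u y * v z\<bar> \<le> \<eta>'"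
    if u: "continuous_on ({0..t} \<times> {1..2} \<times> UNIV) u" and v: "continuous_on ({0..t} \<times> {1..2} \<times> UNIV) v"
    for u v :: "real \<times> real \<times> real \<Rightarrow> real"
  proof -
    have "compact (K \<times> K)" by (auto simp: K_def intro!: compact_Times)
    moreover have "continuous_on (K \<times> K) (\<lambda>w. u (fst w) * v (snd w))"
      using K
      by (intro continuous_on_mult continuous_on_compose2[OF u] continuous_on_compose2[OF v])
        (auto intro: continuous_intros)
    ultimately have "uniformly_continuous_on (K \<times> K) (\<lambda>w. u (fst w) * v (snd w))"
      by (rule compact_uniformly_continuous[rotated])
    then obtain d where d: "d > 0"
      "\<And>w w'. w \<in> K \<times> K \<Longrightarrow> w' \<in> K \<times> K \<Longrightarrow> dist w' w < d \<Longrightarrow>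
        dist (u (fst w') * v (snd w')) (u (fst w) * v (snd w)) < \<eta>'"
      unfolding uniformly_continuous_on_def using \<eta>' by meson
    have "\<bar>u x * v x - u y * v z\<bar> \<le> \<eta>'"
      if "x \<in> K" "y \<in> K" "z \<in> K" "dist x y < d / 2" "dist x z < d / 2" for x y z
    proof -
      have "dist (x, x) (y, z) \<le> dist x y + dist x z"
        using sqrt_sum_squares_le_sum_abs[of "dist x y" "dist x z"] by (simp add: dist_Pair_Pair)
      then show ?thesis
        using d(2)[of "(y, z)" "(x, x)"] that by (simp add: dist_real_def)
    qed
    then show ?thesis using d(1) by (intro exI[of _ "d / 2"]) auto
  qed
  obtain d1 where d1: "0 < d1" "\<And>x y z. x \<in> K \<Longrightarrow> y \<in> K \<Longrightarrow> z \<in> K \<Longrightarrow> dist x y < d1 \<Longrightarrow>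
      dist x z < d1 \<Longrightarrow> \<bar>a x * p x - a y * p z\<bar> \<le> \<eta>'"
    using uniform[OF cont(1,3)] by blast
  obtain d2 where d2: "0 < d2" "\<And>x y z. x \<in> K \<Longrightarrow> y \<in> K \<Longrightarrow> z \<in> K \<Longrightarrow> dist x y < d2 \<Longrightarrow>
      dist x z < d2 \<Longrightarrow> \<bar>b x * q x - b y * q z\<bar> \<le> \<eta>'"
    using uniform[OF cont(2,4)] by blast
  \<comment> \<open>The entry 1 later gives \<open>h * C \<le> 1\<close>, so that an Euler step
    cannot jump across a boundary circle.\<close>
  define d where "d = min 1 (min d1 d2)"
  have d: "0 < d" using d1 d2 by (simp add: d_def)
  obtain N :: nat where N: "t * (1 + 3 * C) / d < real N" using reals_Archimedean2 by blast
  have "0 \<le> t * (1 + 3 * C) / d" using t C d by simp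
  with N have N0: "0 < real N" by linarith
  define h where "h = t / real N"
  have h: "0 < h" "real N * h = t" using t N0 by (auto simp: h_def)
  have small: "h * (1 + 3 * C) < d"
    using N N0 d by (simp add: h_def pos_divide_less_eq mult.commute)
  then have small': "h + 3 * (h * C) < d" by (simp add: algebra_simps)
  have hC: "0 \<le> h * C" "h * C \<le> 1" using small' C h by (auto simp: d_def)
  \<comment> \<open>The radial speed is at most C times the distance to either circle, so a step
    covers at most the fraction h C of that distance.\<close>
  have step_r: "r - h * a (\<tau>, r, \<theta>) \<in> {1..2}" if "\<tau> \<in> {0..t}" "r \<in> {1..2}" for \<tau> r \<theta>
  proof -
    have "h * \<bar>a (\<tau>, r, \<theta>)\<bar> \<le> (h * C) * (r - 1)" "h * \<bar>a (\<tau>, r, \<theta>)\<bar> \<le> (h * C) * (2 - r)"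
      using mult_left_mono[OF a1[OF that], of h] mult_left_mono[OF a2[OF that], of h] h
      by (simp_all add: mult.assoc)
    moreover have "(h * C) * (r - 1) \<le> 1 * (r - 1)" "(h * C) * (2 - r) \<le> 1 * (2 - r)"
      using that hC by (intro mult_right_mono; simp)+
    moreover have "\<bar>h * a (\<tau>, r, \<theta>)\<bar> = h * \<bar>a (\<tau>, r, \<theta>)\<bar>" using h by (simp add: abs_mult)
    ultimately show ?thesis by auto
  qed
  \<comment> \<open>The increment is split into a move in time, one in r and one in \<theta>. By the
    transport equation the first is h (a p + b q), and the other two are -h a p and -h b q at nearby
    points, so only differences of nearby values remain.\<close>
  have step_g: "\<bar>g (\<tau> - h, r - h * a (\<tau>, r, \<theta>), \<theta> - h * b (\<tau>, r, \<theta>)) - g (\<tau>, r, \<theta>)\<bar> \<le> 2 * h * \<eta>'"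
    if \<tau>: "\<tau> \<in> {h..t}" and r: "r \<in> {1..2}" and \<theta>: "\<bar>\<theta> - \<theta>0\<bar> + h * C \<le> t * C" for \<tau> r \<theta>
  proof -
    define r' \<theta>' where "r' = r - h * a (\<tau>, r, \<theta>)" and "\<theta>' = \<theta> - h * b (\<tau>, r, \<theta>)"
    have \<tau>': "\<tau> \<in> {0..t}" "\<tau> - h \<in> {0..t}" using \<tau> h by auto
    have r': "r' \<in> {1..2}" unfolding r'_def by (rule step_r[OF \<tau>'(1) r])
    have dr: "\<bar>r' - r\<bar> \<le> h * C" and d\<theta>: "\<bar>\<theta>' - \<theta>\<bar> \<le> h * C"
      using a[OF \<tau>'(1) r, of \<theta>] b[OF \<tau>'(1) r, of \<theta>] h
      by (simp_all add: r'_def \<theta>'_def abs_mult mult_left_mono)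
    obtain \<sigma> where \<sigma>: "\<sigma> \<in> {0..t}" "\<bar>\<sigma> - \<tau>\<bar> \<le> \<bar>\<tau> - h - \<tau>\<bar>"
      "g (\<tau> - h, r', \<theta>') - g (\<tau>, r', \<theta>') = (\<tau> - h - \<tau>) *
        - (a (\<sigma>, r', \<theta>') * p (\<sigma>, r', \<theta>') + b (\<sigma>, r', \<theta>') * q (\<sigma>, r', \<theta>'))"
      by (rule mvt_between[of "{0..t}" \<tau> "\<tau> - h" "\<lambda>\<tau>. g (\<tau>, r', \<theta>')"
          "\<lambda>\<sigma>. - (a (\<sigma>, r', \<theta>') * p (\<sigma>, r', \<theta>') + b (\<sigma>, r', \<theta>') * q (\<sigma>, r', \<theta>'))"])
        (use \<tau>' in \<open>auto intro!: has_field_derivative_at_within gt[OF _ r', simplified]\<close>)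
    obtain s where s: "s \<in> {1..2}" "\<bar>s - r'\<bar> \<le> \<bar>r' - r\<bar>"
      "g (\<tau>, r', \<theta>') - g (\<tau>, r, \<theta>') = (r' - r) * p (\<tau>, s, \<theta>')"
      by (rule mvt_between[of "{1..2}" r r' "\<lambda>r. g (\<tau>, r, \<theta>')" "\<lambda>r. p (\<tau>, r, \<theta>')"])
        (use r r' gr[OF \<tau>'(1)] in auto)
    obtain \<alpha> where \<alpha>: "\<bar>\<alpha> - \<theta>\<bar> \<le> \<bar>\<theta>' - \<theta>\<bar>" "\<bar>\<alpha> - \<theta>'\<bar> \<le> \<bar>\<theta>' - \<theta>\<bar>"
      "g (\<tau>, r, \<theta>') - g (\<tau>, r, \<theta>) = (\<theta>' - \<theta>) * q (\<tau>, r, \<alpha>)"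
      by (rule mvt_between[of UNIV \<theta> \<theta>' "\<lambda>\<theta>. g (\<tau>, r, \<theta>)" "\<lambda>\<theta>. q (\<tau>, r, \<theta>)"])
        (use g\<theta>[OF \<tau>'(1) r] in auto)
    have inK: "(\<sigma>, r', \<theta>') \<in> K" "(\<tau>, r, \<theta>) \<in> K" "(\<tau>, s, \<theta>') \<in> K" "(\<tau>, r, \<alpha>) \<in> K"
      using \<sigma>(1) s(1) \<alpha>(1) r r' \<tau>'(1) \<theta> d\<theta> hC(1) unfolding K_def by (auto simp: abs_le_iff)
    have close: "dist (\<sigma>, r', \<theta>') (\<tau>, r, \<theta>) < d" "dist (\<sigma>, r', \<theta>') (\<tau>, s, \<theta>') < d"
      "dist (\<sigma>, r', \<theta>') (\<tau>, r, \<alpha>) < d"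
      using dist_triple_le[of \<sigma> r' \<theta>' \<tau> r \<theta>] dist_triple_le[of \<sigma> r' \<theta>' \<tau> s \<theta>']
        dist_triple_le[of \<sigma> r' \<theta>' \<tau> r \<alpha>] \<sigma>(2) s(2) \<alpha>(2) dr d\<theta> small' hC h(1)
      by linarith+
    have "g (\<tau> - h, r', \<theta>') - g (\<tau>, r, \<theta>) =
      h * ((a (\<sigma>, r', \<theta>') * p (\<sigma>, r', \<theta>') - a (\<tau>, r, \<theta>) * p (\<tau>, s, \<theta>'))
        + (b (\<sigma>, r', \<theta>') * q (\<sigma>, r', \<theta>') - b (\<tau>, r, \<theta>) * q (\<tau>, r, \<alpha>)))"
      using \<sigma>(3) s(3) \<alpha>(3) by (simp add: r'_def \<theta>'_def algebra_simps)
    moreover have "\<bar>a (\<sigma>, r', \<theta>') * p (\<sigma>, r', \<theta>') - a (\<tau>, r, \<theta>) * p (\<tau>, s, \<theta>')\<bar> \<le> \<eta>'"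
      using d1(2)[OF inK(1,2,3)] close by (simp add: d_def)
    moreover have "\<bar>b (\<sigma>, r', \<theta>') * q (\<sigma>, r', \<theta>') - b (\<tau>, r, \<theta>) * q (\<tau>, r, \<alpha>)\<bar> \<le> \<eta>'"
      using d2(2)[OF inK(1,2,4)] close by (simp add: d_def)
    ultimately have "\<bar>g (\<tau> - h, r', \<theta>') - g (\<tau>, r, \<theta>)\<bar> \<le> h * (2 * \<eta>')"
      using h(1) by (auto simp: abs_mult intro!: mult_left_mono)
    then show ?thesis by (simp add: r'_def \<theta>'_def mult_ac)
  qed
  \<comment> \<open>The invariant keeps the ends on the circles, where \<open>a\<close> vanishes and
    the bounds \<open>m1\<close> and \<open>m2\<close> apply, and limits the drift of the angle so
    that the next step stays in \<open>K\<close>. Composition with the continuous coefficients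
    preserves continuity in r.\<close>
  have "\<exists>R \<Theta>. continuous_on {1..2} R \<and> continuous_on {1..2} \<Theta> \<and>
      (\<forall>r\<in>{1..2}. R r \<in> {1..2} \<and> \<bar>\<Theta> r - \<theta>0\<bar> \<le> real k * h * C \<and>
        \<bar>g (t - real k * h, R r, \<Theta> r) - g (t, r, \<theta>0)\<bar> \<le> real k * (2 * h * \<eta>')) \<and>
      R 1 = 1 \<and> R 2 = 2 \<and> \<Theta> 1 \<le> \<theta>0 - real k * h * m1 \<and> \<theta>0 - real k * h * m2 \<le> \<Theta> 2"
    if "k \<le> N" for k
    using that
  proof (induction k)
    case 0
    show ?case by (rule exI[of _ "\<lambda>r. r"], rule exI[of _ "\<lambda>_. \<theta>0"]) simp
  next
    case (Suc k)
    then obtain R \<Theta> where R: "continuous_on {1..2} R" and \<Theta>: "continuous_on {1..2} \<Theta>"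
      and R12: "\<And>r. r \<in> {1..2} \<Longrightarrow> R r \<in> {1..2}"
      and \<Theta>b: "\<And>r. r \<in> {1..2} \<Longrightarrow> \<bar>\<Theta> r - \<theta>0\<bar> \<le> real k * h * C"
      and g: "\<And>r. r \<in> {1..2} \<Longrightarrow>
        \<bar>g (t - real k * h, R r, \<Theta> r) - g (t, r, \<theta>0)\<bar> \<le> real k * (2 * h * \<eta>')"
      and ends: "R 1 = 1" "R 2 = 2" "\<Theta> 1 \<le> \<theta>0 - real k * h * m1" "\<theta>0 - real k * h * m2 \<le> \<Theta> 2"
      by auto
    define \<tau> where "\<tau> = t - real k * h"
    have "real (Suc k) * h \<le> real N * h" using Suc.prems h(1) by (intro mult_right_mono) auto
    then have kh: "real k * h + h \<le> t" using h(2) by (simp add: algebra_simps)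
    have "0 \<le> real k * h" using h(1) by simp
    then have \<tau>: "\<tau> \<in> {h..t}" "\<tau> \<in> {0..t}" using kh h(1) by (auto simp: \<tau>_def)
    have khC: "real k * h * C + h * C \<le> t * C"
      using mult_right_mono[OF kh C] by (simp add: algebra_simps)
    define R' \<Theta>' where "R' r = R r - h * a (\<tau>, R r, \<Theta> r)" and "\<Theta>' r = \<Theta> r - h * b (\<tau>, R r, \<Theta> r)" for r
    have comp: "continuous_on {1..2} (\<lambda>r. u (\<tau>, R r, \<Theta> r))"
      if "continuous_on ({0..t} \<times> {1..2} \<times> UNIV) u" for u :: "real \<times> real \<times> real \<Rightarrow> real"
      using \<tau> R12 by (intro continuous_on_compose2[OF that] continuous_on_Pair continuous_on_const R \<Theta>) auto
    have "continuous_on {1..2} R'" "continuous_on {1..2} \<Theta>'"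
      unfolding R'_def \<Theta>'_def by (intro continuous_intros R \<Theta> comp cont)+
    moreover have "R' r \<in> {1..2}" if "r \<in> {1..2}" for r
      unfolding R'_def by (rule step_r[OF \<tau>(2) R12[OF that]])
    moreover have "\<bar>\<Theta>' r - \<theta>0\<bar> \<le> real (Suc k) * h * C" if "r \<in> {1..2}" for r
    proof -
      have "\<bar>h * b (\<tau>, R r, \<Theta> r)\<bar> \<le> h * C"
        using b[OF \<tau>(2) R12[OF that]] h(1) by (simp add: abs_mult mult_left_mono)
      then have "\<bar>\<Theta>' r - \<theta>0\<bar> \<le> real k * h * C + h * C"
        using \<Theta>b[OF that] unfolding \<Theta>'_def by linarith
      then show ?thesis by (simp add: algebra_simps)
    qed
    moreover have "\<bar>g (t - real (Suc k) * h, R' r, \<Theta>' r) - g (t, r, \<theta>0)\<bar> \<le> real (Suc k) * (2 * h * \<eta>')"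
      if "r \<in> {1..2}" for r
    proof -
      have "\<bar>g (\<tau> - h, R' r, \<Theta>' r) - g (\<tau>, R r, \<Theta> r)\<bar> \<le> 2 * h * \<eta>'"
        unfolding R'_def \<Theta>'_def
        by (rule step_g[OF \<tau>(1) R12[OF that]]) (use \<Theta>b[OF that] khC in linarith)
      moreover have "\<tau> - h = t - real (Suc k) * h" by (simp add: \<tau>_def algebra_simps)
      moreover have "real (Suc k) * (2 * h * \<eta>') = real k * (2 * h * \<eta>') + 2 * h * \<eta>'"
        by (simp add: algebra_simps)
      ultimately show ?thesis using g[OF that] unfolding \<tau>_def by (smt (verit))
    qed
    moreover have "R' 1 = 1" "R' 2 = 2"
      using a1[OF \<tau>(2), of 1 "\<Theta> 1"] a2[OF \<tau>(2), of 2 "\<Theta> 2"] by (simp_all add: R'_def ends)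
    moreover have "\<Theta>' 1 \<le> \<theta>0 - real (Suc k) * h * m1" "\<theta>0 - real (Suc k) * h * m2 \<le> \<Theta>' 2"
    proof -
      have "h * m1 \<le> h * b (\<tau>, R 1, \<Theta> 1)" "h * b (\<tau>, R 2, \<Theta> 2) \<le> h * m2"
        using m1[OF \<tau>(2)] m2[OF \<tau>(2)] ends h(1) by (simp_all add: mult_left_mono)
      then show "\<Theta>' 1 \<le> \<theta>0 - real (Suc k) * h * m1" "\<theta>0 - real (Suc k) * h * m2 \<le> \<Theta>' 2"
        using ends(3,4) unfolding \<Theta>'_def by (simp_all add: algebra_simps)
    qed
    ultimately show ?case by (intro exI[of _ R'] exI[of _ \<Theta>']) simp
  qed
  from this[of N] obtain R \<Theta> where *: "continuous_on {1..2} R" "continuous_on {1..2} \<Theta>"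
    "\<And>r. r \<in> {1..2} \<Longrightarrow> R r \<in> {1..2}"
    "\<And>r. r \<in> {1..2} \<Longrightarrow> \<bar>g (t - real N * h, R r, \<Theta> r) - g (t, r, \<theta>0)\<bar> \<le> real N * (2 * h * \<eta>')"
    "\<Theta> 1 \<le> \<theta>0 - real N * h * m1" "\<theta>0 - real N * h * m2 \<le> \<Theta> 2"
    by auto
  have "real N * (2 * h * \<eta>') = 2 * t * \<eta>'" using h(2) by (simp add: mult_ac)
  also have "\<dots> = \<eta>" using t by (simp add: \<eta>'_def)
  finally show thesis using that[of R \<Theta>] * by (simp add: h(2))
qed

section \<open>Divergence-free fields tangent to the boundary\<close>

lemma tangent_period [simp]: "tangent (\<theta> + 2 * pi * of_int n) = tangent \<theta>"
  by (simp add: tangent_eq sin_add cos_add)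

lemma norm_tangent [simp]: "norm (tangent \<theta>) = 1"
  by (simp add: tangent_def norm_vec_def L2_set_def sum_2)

lemma inner_circle_nth [simp]: "inner_circle \<theta> $ 1 = cos \<theta>" "inner_circle \<theta> $ 2 = sin \<theta>"
  by (simp_all add: inner_circle_def)

lemma tangent_nth [simp]: "tangent \<theta> $ 1 = - sin \<theta>" "tangent \<theta> $ 2 = cos \<theta>"
  by (simp_all add: tangent_def)

lemma inner_real2: "(x :: real^2) \<bullet> y = x $ 1 * y $ 1 + x $ 2 * y $ 2"
  by (simp add: inner_vec_def sum_2)

lemma continuous_on_polar:
  fixes \<rho> \<alpha> :: "'a::t2_space \<Rightarrow> real"
  assumes "continuous_on annulus F" "continuous_on S \<rho>" "continuous_on S \<alpha>" "\<rho> ` S \<subseteq> {1..2}"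
  shows "continuous_on S (\<lambda>x. F (\<rho> x *\<^sub>R inner_circle (\<alpha> x)))"
  using assms(4)
  by (intro continuous_on_compose2[OF assms(1)] continuous_intros assms(2,3)) (auto simp: image_subset_iff)

text \<open>A single time slice of a velocity field. The curl is left open and enters only through
  bounds on it.\<close>

locale annulus_field =
  fixes v :: "real^2 \<Rightarrow> real^2"
  assumes C1: "(\<lambda>x. v x $ i) \<in> C1_annulus"
    and divergence_free: "x \<in> annulus \<Longrightarrow> divergence v x = 0"
    and slip: "norm x = 1 \<or> norm x = 2 \<Longrightarrow> v x \<bullet> unit_normal x = 0"
begin

definition U :: "real \<Rightarrow> real \<Rightarrow> real" where
  "U r \<theta> = v (r *\<^sub>R inner_circle \<theta>) \<bullet> inner_circle \<theta>"

definition V :: "real \<Rightarrow> real \<Rightarrow> real" where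
  "V r \<theta> = v (r *\<^sub>R inner_circle \<theta>) \<bullet> tangent \<theta>"

definition G :: "2 \<Rightarrow> real \<Rightarrow> real \<Rightarrow> real^2" where
  "G i r \<theta> = grad (\<lambda>x. v x $ i) (r *\<^sub>R inner_circle \<theta>)"

text \<open>This and the next three are the partial derivatives of U and V in r and \<theta>.
  Written out in entries of the velocity gradient, they turn the divergence and curl relations into
  algebraic identities.\<close>

definition Ur :: "real \<Rightarrow> real \<Rightarrow> real" where
  "Ur r \<theta> = (G 1 r \<theta> \<bullet> inner_circle \<theta>) * cos \<theta> + (G 2 r \<theta> \<bullet> inner_circle \<theta>) * sin \<theta>"

definition Vr :: "real \<Rightarrow> real \<Rightarrow> real" where
  "Vr r \<theta> = (G 2 r \<theta> \<bullet> inner_circle \<theta>) * cos \<theta> - (G 1 r \<theta> \<bullet> inner_circle \<theta>) * sin \<theta>"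

definition Ut :: "real \<Rightarrow> real \<Rightarrow> real" where
  "Ut r \<theta> = r * (G 1 r \<theta> \<bullet> tangent \<theta>) * cos \<theta> + r * (G 2 r \<theta> \<bullet> tangent \<theta>) * sin \<theta> + V r \<theta>"

definition Vt :: "real \<Rightarrow> real \<Rightarrow> real" where
  "Vt r \<theta> = r * (G 2 r \<theta> \<bullet> tangent \<theta>) * cos \<theta> - r * (G 1 r \<theta> \<bullet> tangent \<theta>) * sin \<theta> - U r \<theta>"

lemma UV_eq:
  "U r \<theta> = v (r *\<^sub>R inner_circle \<theta>) $ 1 * cos \<theta> + v (r *\<^sub>R inner_circle \<theta>) $ 2 * sin \<theta>"
  "V r \<theta> = v (r *\<^sub>R inner_circle \<theta>) $ 2 * cos \<theta> - v (r *\<^sub>R inner_circle \<theta>) $ 1 * sin \<theta>"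
  by (simp_all add: U_def V_def inner_real2)

lemma has_derivative_radius:
  assumes "r \<in> {1..2}"
  shows "((\<lambda>r. U r \<theta>) has_real_derivative Ur r \<theta>) (at r within {1..2})"
    and "((\<lambda>r. V r \<theta>) has_real_derivative Vr r \<theta>) (at r within {1..2})"
  unfolding UV_eq Ur_def Vr_def G_def
  by (auto intro!: derivative_eq_intros polar_has_derivative_radius[OF C1 assms])

lemma has_derivative_angle:
  assumes "r \<in> {1..2}"
  shows "(U r has_real_derivative Ut r \<theta>) (at \<theta>)"
    and "(V r has_real_derivative Vt r \<theta>) (at \<theta>)"
  unfolding UV_eq[abs_def] Ut_def Vt_def G_def
  by (auto intro!: derivative_eq_intros polar_has_derivative_angle[OF C1 assms] simp: UV_eq algebra_simps)

text \<open>The right-hand side is minus the r-derivative of r U; this exact form allows the angular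
  derivative of \<open>stream\<close> to be integrated.\<close>

lemma divergence_polar:
  assumes "r \<in> {1..2}"
  shows "Vt r \<theta> = - (r * Ur r \<theta> + U r \<theta>)"
proof -
  have "G 1 r \<theta> $ 1 + G 2 r \<theta> $ 2 = 0"
    using divergence_free[OF polar_in_annulus[OF assms]] by (simp add: divergence_def sum_2 G_def grad_def)
  then have G2: "G 2 r \<theta> $ 2 = - G 1 r \<theta> $ 1" by simp
  have sq: "(sin \<theta>)\<^sup>2 = 1 - (cos \<theta>)\<^sup>2" by (simp add: sin_squared_eq)
  show ?thesis
    by (simp add: Vt_def Ur_def inner_real2 G2 algebra_simps power2_eq_square[symmetric] sq)
qed

text \<open>With \<psi> for the stream function, V = \<psi>_r and -r U = \<psi>_\<theta>, so the
  left-hand side is the polar Laplacian of \<psi>.\<close>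

lemma curl_polar:
  assumes "r \<in> {1..2}"
  shows "Vr r \<theta> + V r \<theta> / r - Ut r \<theta> / r = curl v (r *\<^sub>R inner_circle \<theta>)"
proof -
  have c: "curl v (r *\<^sub>R inner_circle \<theta>) = G 2 r \<theta> $ 1 - G 1 r \<theta> $ 2"
    by (simp add: curl_def G_def grad_def)
  have "Ut r \<theta> / r = (G 1 r \<theta> \<bullet> tangent \<theta>) * cos \<theta> + (G 2 r \<theta> \<bullet> tangent \<theta>) * sin \<theta> + V r \<theta> / r"
    using assms by (simp add: Ut_def add_divide_distrib)
  then have "Vr r \<theta> + V r \<theta> / r - Ut r \<theta> / r =
      (G 2 r \<theta> $ 1 - G 1 r \<theta> $ 2) * ((sin \<theta>)\<^sup>2 + (cos \<theta>)\<^sup>2)"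
    unfolding Vr_def inner_real2 inner_circle_nth tangent_nth by algebra
  then show ?thesis by (simp add: c)
qed

lemma U_boundary: "U 1 \<theta> = 0" "U 2 \<theta> = 0"
  using slip[of "inner_circle \<theta>"] slip[of "2 *\<^sub>R inner_circle \<theta>"]
  by (simp_all add: U_def unit_normal_def)

lemma continuous_on_v: "continuous_on annulus v"
proof -
  have "continuous_on annulus (\<lambda>x. v x $ i)" for i
    using C1[of i] by (simp add: C1_annulus_def differentiable_imp_continuous_on)
  then have "continuous_on annulus (\<lambda>x. \<chi> i. v x $ i)" by (rule continuous_on_vec_lambda)
  then show ?thesis by (simp only: vec_lambda_eta)
qed

lemma continuous_on_V:
  fixes \<rho> \<alpha> :: "'a::t2_space \<Rightarrow> real"
  assumes "continuous_on S \<rho>" "continuous_on S \<alpha>" "\<rho> ` S \<subseteq> {1..2}"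
  shows "continuous_on S (\<lambda>x. V (\<rho> x) (\<alpha> x))" "continuous_on S (\<lambda>x. Vt (\<rho> x) (\<alpha> x))"
proof -
  have "continuous_on annulus (grad (\<lambda>x. v x $ i))" for i
    using C1 by (simp add: C1_annulus_def)
  note cont = continuous_on_polar[OF this assms] continuous_on_polar[OF continuous_on_v assms]
  show "continuous_on S (\<lambda>x. V (\<rho> x) (\<alpha> x))" "continuous_on S (\<lambda>x. Vt (\<rho> x) (\<alpha> x))"
    unfolding V_def Vt_def U_def G_def
    by (intro continuous_intros continuous_on_cos continuous_on_sin cont assms)+
qed

section \<open>Stream function and bounds for the boundary velocity\<close>

text \<open>The stream function normalised to vanish on the inner circle. Integrating along rays
  makes it single-valued without any argument about path independence.\<close>

definition stream :: "real \<Rightarrow> real \<Rightarrow> real" where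
  "stream r \<theta> = integral {1..r} (\<lambda>s. V s \<theta>)"

lemma stream_has_derivative_radius:
  assumes "r \<in> {1..2}"
  shows "((\<lambda>r. stream r \<theta>) has_real_derivative V r \<theta>) (at r within {1..2})"
  unfolding stream_def
  by (rule integral_has_real_derivative[OF _ assms])
    (intro continuous_on_V continuous_intros, auto)

text \<open>Under the integral, incompressibility turns the \<theta>-derivative of V into minus the
  r-derivative of r U, and the lower end contributes nothing because U vanishes on the inner
  circle.\<close>

lemma stream_has_derivative_angle:
  assumes r: "r \<in> {1..2}"
  shows "(stream r has_real_derivative - r * U r \<theta>) (at \<theta>)"
proof -
  have "((\<lambda>\<theta>. integral (cbox 1 r) (\<lambda>s. V s \<theta>)) has_real_derivative
      integral (cbox 1 r) (\<lambda>s. Vt s \<theta>)) (at \<theta> within UNIV)"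
  proof (rule leibniz_rule_field_derivative)
    show "((\<lambda>\<theta>. V s \<theta>) has_real_derivative Vt s \<theta>) (at \<theta> within UNIV)" if "s \<in> cbox 1 r" for \<theta> s
      using has_derivative_angle(2)[of s] that r by auto
    show "(\<lambda>s. V s \<theta>) integrable_on cbox 1 r" for \<theta>
      by (rule integrable_continuous, intro continuous_on_V continuous_intros) (use r in auto)
    have "continuous_on (UNIV \<times> cbox 1 r) (\<lambda>x. Vt (snd x) (fst x))"
      by (intro continuous_on_V continuous_intros) (use r in auto)
    then show "continuous_on (UNIV \<times> cbox 1 r) (\<lambda>(\<theta>, s). Vt s \<theta>)"
      by (simp add: case_prod_beta')
  qed auto
  moreover have "((\<lambda>s. Vt s \<theta>) has_integral (- r * U r \<theta> - (- 1 * U 1 \<theta>))) {1..r}"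
  proof (rule fundamental_theorem_of_calculus)
    fix s assume "s \<in> {1..r}"
    then have s: "s \<in> {1..2}" and sub: "{1..r} \<subseteq> {1..2}" using r by auto
    have "((\<lambda>s. - s * U s \<theta>) has_real_derivative Vt s \<theta>) (at s within {1..2})"
      unfolding divergence_polar[OF s]
      by (auto intro!: derivative_eq_intros has_derivative_radius[OF s])
    then show "((\<lambda>s. - s * U s \<theta>) has_vector_derivative Vt s \<theta>) (at s within {1..r})"
      using has_field_derivative_subset[OF _ sub]
      by (simp add: has_real_derivative_iff_has_vector_derivative[symmetric])
  qed (use r in simp)
  ultimately show ?thesis
    by (simp add: stream_def[abs_def] U_boundary integral_unique)
qed

lemma stream_continuous: "continuous_on ({1..2} \<times> UNIV) (\<lambda>(r, \<theta>). stream r \<theta>)"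
proof -
  obtain B where B: "\<And>x. x \<in> annulus \<Longrightarrow> norm (v x) \<le> B"
    using compact_imp_bounded[OF compact_continuous_image[OF continuous_on_v compact_annulus]]
    unfolding bounded_iff by blast
  show ?thesis
  proof (rule continuous_on_strip[where f' = V and B = B])
    show "\<bar>V r \<theta>\<bar> \<le> B" if "r \<in> {1..2}" for r \<theta>
      using Cauchy_Schwarz_ineq2[of "v (r *\<^sub>R inner_circle \<theta>)" "tangent \<theta>"]
        B[OF polar_in_annulus[OF that, of \<theta>]] by (simp add: V_def)
    show "continuous_on UNIV (stream r)" if "r \<in> {1..2}" for r
      using DERIV_isCont[OF stream_has_derivative_angle[OF that]]
      by (simp add: continuous_at_imp_continuous_on)
  qed (rule stream_has_derivative_radius)
qed

text \<open>The outer circle is a streamline, as U vanishes there. The constant is the flux across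
  every radial segment.\<close>

lemma stream_outer: "stream 2 \<theta> = stream 2 0"
  using DERIV_isconst_all[of "stream 2" \<theta> 0] stream_has_derivative_angle[of 2]
  by (simp add: U_boundary)

text \<open>
  Comparison of the stream function with the radial solution of \<open>\<Delta>h = m\<close> that has the same
  boundary values; \<open>e = 1\<close> and \<open>e = - 1\<close> are the cases of a subsolution and of a supersolution.
\<close>

lemma barrier:
  assumes curl: "\<And>x. x \<in> annulus \<Longrightarrow> 0 < e * (curl v x - m)"
    and \<beta>: "stream 2 0 = 3 * m / 4 + \<beta> * ln 2"
  shows "e * (V 1 \<theta> - (m / 2 + \<beta>)) \<le> 0" "0 \<le> e * (V 2 \<theta> - (m + \<beta> / 2))"
proof -
  \<comment> \<open>The general radial solution of h'' + h' / r = m with h(1) = 0. The assumption on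
    \<beta> makes h(2) the boundary value of the stream function, and the claimed bounds contain
    h'(1) and h'(2).\<close>
  define h where "h r = m * (r\<^sup>2 - 1) / 4 + \<beta> * ln r" for r :: real
  define h' where "h' r = m * r / 2 + \<beta> / r" for r :: real
  have h: "(h has_real_derivative h' r) (at r within S)" if "0 < r" for r S
    unfolding h_def h'_def using that
    by (auto intro!: derivative_eq_intros simp: field_simps)
  have h': "(h' has_real_derivative (m / 2 - \<beta> / r\<^sup>2)) (at r within S)" if "0 < r" for r S
    unfolding h'_def using that
    by (auto intro!: derivative_eq_intros simp: field_simps power2_eq_square)
  define f where "f r \<theta> = e * (stream r \<theta> - h r)" for r \<theta>
  have f_deriv: "((\<lambda>r. f r \<theta>) has_real_derivative e * (V r \<theta> - h' r)) (at r within {1..2})"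
    if "r \<in> {1..2}" for r \<theta>
    unfolding f_def using that
    by (intro DERIV_cmult DERIV_diff stream_has_derivative_radius h) auto
  have ends: "f 1 \<theta> = 0" "f 2 \<theta> = 0" for \<theta>
    by (simp add: f_def h_def stream_def) (simp add: f_def h_def stream_outer[of \<theta>] \<beta>)
  have f_le: "f r \<theta> \<le> 0" if "r \<in> {1..2}" for r \<theta>
  proof (rule polar_max_principle[where \<phi> = f and \<phi>r = "\<lambda>r \<theta>. e * (V r \<theta> - h' r)"
        and \<phi>rr = "\<lambda>r \<theta>. e * (Vr r \<theta> - (m / 2 - \<beta> / r\<^sup>2))" and \<phi>t = "\<lambda>r \<theta>. e * (- r * U r \<theta>)"
        and \<phi>tt = "\<lambda>r \<theta>. e * (- r * Ut r \<theta>)"])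
    show "f r (\<theta> + 2 * pi * of_int n) = f r \<theta>" for r \<theta> n
      by (simp add: f_def stream_def V_def)
    have "continuous_on ({1..2} \<times> UNIV) (\<lambda>x. h (fst x) :: real)"
      unfolding h_def by (intro continuous_intros) auto
    then have "continuous_on ({1..2} \<times> UNIV) (\<lambda>x. e * ((\<lambda>(r, \<theta>). stream r \<theta>) x - h (fst x)))"
      by (intro continuous_intros stream_continuous)
    then show "continuous_on ({1..2} \<times> UNIV) (\<lambda>(r, \<theta>). f r \<theta>)"
      by (simp add: f_def case_prod_beta')
    fix r \<theta> :: real assume "1 < r" "r < 2"
    then have r: "r \<in> {1..2}" "0 < r" and at_r: "at r within {1..2} = at r"
      by (auto intro: at_within_Icc_at)
    show "((\<lambda>r. f r \<theta>) has_real_derivative e * (V r \<theta> - h' r)) (at r)"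
      using f_deriv[OF r(1)] at_r by simp
    show "((\<lambda>r. e * (V r \<theta> - h' r)) has_real_derivative e * (Vr r \<theta> - (m / 2 - \<beta> / r\<^sup>2))) (at r)"
      using has_derivative_radius(2)[OF r(1), of \<theta>] at_r r
      by (intro DERIV_cmult DERIV_diff h') auto
    show "(f r has_real_derivative e * (- r * U r \<theta>)) (at \<theta>)"
      unfolding f_def[abs_def]
      by (auto intro!: derivative_eq_intros stream_has_derivative_angle[OF r(1)])
    show "((\<lambda>\<theta>. e * (- r * U r \<theta>)) has_real_derivative e * (- r * Ut r \<theta>)) (at \<theta>)"
      by (auto intro!: derivative_eq_intros has_derivative_angle[OF r(1)])
    have "e * (Vr r \<theta> - (m / 2 - \<beta> / r\<^sup>2)) + e * (V r \<theta> - h' r) / r + e * (- r * Ut r \<theta>) / r\<^sup>2 =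
      e * (Vr r \<theta> + V r \<theta> / r - Ut r \<theta> / r - m)"
      using r by (simp add: h'_def field_simps power2_eq_square)
    then show "0 < e * (Vr r \<theta> - (m / 2 - \<beta> / r\<^sup>2)) + e * (V r \<theta> - h' r) / r + e * (- r * Ut r \<theta>) / r\<^sup>2"
      using curl[OF polar_in_annulus[OF r(1), of \<theta>]] by (simp add: curl_polar[OF r(1)])
  qed (use ends that in auto)
  \<comment> \<open>Since f is nonpositive and vanishes on both circles, it cannot increase when
    leaving r = 1 nor decrease when arriving at r = 2.\<close>
  have "e * (V 1 \<theta> - h' 1) \<le> 0"
  proof (rule ccontr)
    assume "\<not> ?thesis"
    then obtain d where d: "0 < d" "\<And>k. 0 < k \<Longrightarrow> 1 + k \<in> {1..2} \<Longrightarrow> k < d \<Longrightarrow> f 1 \<theta> < f (1 + k) \<theta>"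
      using has_real_derivative_pos_inc_right[OF f_deriv[of 1 \<theta>]] by auto
    with f_le[of "1 + min (d / 2) 1" \<theta>] ends show False
      by (smt (verit) atLeastAtMost_iff field_sum_of_halves)
  qed
  then show "e * (V 1 \<theta> - (m / 2 + \<beta>)) \<le> 0" by (simp add: h'_def)
  have "0 \<le> e * (V 2 \<theta> - h' 2)"
  proof (rule ccontr)
    assume "\<not> ?thesis"
    then obtain d where d: "0 < d" "\<And>k. 0 < k \<Longrightarrow> 2 - k \<in> {1..2} \<Longrightarrow> k < d \<Longrightarrow> f 2 \<theta> < f (2 - k) \<theta>"
      using has_real_derivative_neg_dec_left[OF f_deriv[of 2 \<theta>]] by auto
    with f_le[of "2 - min (d / 2) 1" \<theta>] ends show False
      by (smt (verit) atLeastAtMost_iff field_sum_of_halves)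
  qed
  then show "0 \<le> e * (V 2 \<theta> - (m + \<beta> / 2))" by (simp add: h'_def)
qed

lemma inner_circulation_eq: "inner_circulation v = integral {0..2 * pi} (V 1)"
  by (simp add: inner_circulation_def V_def[abs_def]
      vector_derivative_at[OF inner_circle_has_vector_derivative])

text \<open>The barriers with m = c - d and m = c + d bound V on the circles in terms of the unknown
  flux. Averaging the inner bounds over the circle, where the mean of V is s, gives one inequality
  for each of \<beta>1 and \<beta>2. For c = const and d = 0 the bounds become the exact angular
  velocities s and 3 c / 8 + s / 4 of the rotating steady flow.\<close>

lemma boundary_velocity:
  assumes curl: "\<And>x. x \<in> annulus \<Longrightarrow> \<bar>curl v x - c\<bar> < d"
  defines "s \<equiv> inner_circulation v / (2 * pi)"
  shows "s - 5 / 4 * d \<le> V 1 \<theta>" "V 2 \<theta> / 2 \<le> 3 / 8 * c + s / 4 + 3 / 8 * d"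
proof -
  define \<beta>1 \<beta>2 where "\<beta>1 = (stream 2 0 - 3 * (c - d) / 4) / ln 2"
    and "\<beta>2 = (stream 2 0 - 3 * (c + d) / 4) / ln 2"
  have d: "0 < d" using curl[of "inner_circle 0"] by (simp add: annulus_def)
  have sub: "V 1 \<theta> - ((c - d) / 2 + \<beta>1) \<le> 0" for \<theta>
    using barrier(1)[of 1 "c - d" \<beta>1 \<theta>] curl by (force simp: \<beta>1_def abs_less_iff)
  have super: "0 \<le> V 1 \<theta> - ((c + d) / 2 + \<beta>2)" "V 2 \<theta> - (c + d + \<beta>2 / 2) \<le> 0" for \<theta>
    using barrier[of "- 1" "c + d" \<beta>2 \<theta>] curl by (force simp: \<beta>2_def abs_less_iff)+
  have int: "V 1 integrable_on {0..2 * pi}"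
    by (intro integrable_continuous_interval continuous_on_V continuous_intros) auto
  have "integral {0..2 * pi} (V 1) \<le> integral {0..2 * pi} (\<lambda>_. (c - d) / 2 + \<beta>1)"
    by (rule integral_le[OF int]) (use sub in auto)
  then have s1: "s \<le> (c - d) / 2 + \<beta>1"
    by (simp add: s_def inner_circulation_eq pos_divide_le_eq mult.commute)
  have "integral {0..2 * pi} (\<lambda>_. (c + d) / 2 + \<beta>2) \<le> integral {0..2 * pi} (V 1)"
    by (rule integral_le[OF _ int]) (use super(1) in auto)
  then have s2: "(c + d) / 2 + \<beta>2 \<le> s"
    by (simp add: s_def inner_circulation_eq pos_le_divide_eq mult.commute)
  \<comment> \<open>The flux cancels here, so the inequality for \<beta>1 can be used to bound
    \<beta>2 from below.\<close>
  have "\<beta>1 - \<beta>2 = (3 * d / 2) / ln 2"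
    by (simp add: \<beta>1_def \<beta>2_def flip: diff_divide_distrib)
  also have "\<dots> \<le> (3 * d / 2) / (2 / 3)"
    using ln2_ge_two_thirds d by (intro divide_left_mono) auto
  finally have \<beta>: "\<beta>1 - \<beta>2 \<le> 9 / 4 * d" by simp
  show "s - 5 / 4 * d \<le> V 1 \<theta>" using super(1)[of \<theta>] s1 \<beta> by (simp add: field_simps)
  show "V 2 \<theta> / 2 \<le> 3 / 8 * c + s / 4 + 3 / 8 * d" using super(2)[of \<theta>] s2 by (simp add: field_simps)
qed

end

section \<open>From winding to a large gradient\<close>

text \<open>On one half of [1, 2] the angle grows by at least 2 pi, so its cosine takes both values
  1 and -1 there. The function then differs by at least 1 - 2 * 3/8 = 1/4 between two points at
  distance at most 1/2. Asking for two turns and keeping the better half doubles the slope that one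
  turn over the whole segment would give.\<close>

lemma oscillation_gives_gradient:
  fixes \<omega> :: "real^2 \<Rightarrow> real"
  assumes \<omega>: "\<omega> \<in> C1_annulus"
    and cont: "continuous_on {1..2} \<Theta>" and turns: "4 * pi \<le> \<Theta> 2 - \<Theta> 1"
    and close: "\<And>r. r \<in> {1..2} \<Longrightarrow> \<bar>\<omega> (r *\<^sub>R inner_circle 0) - (c + cos (\<Theta> r) / 2)\<bar> \<le> 3 / 8"
  shows "1 / 2 \<le> C1_norm \<omega>"
proof -
  obtain x :: real where x: "1 \<le> x" "x + 1 / 2 \<le> 2" "2 * pi \<le> \<Theta> (x + 1 / 2) - \<Theta> x"
  proof (cases "2 * pi \<le> \<Theta> (3 / 2) - \<Theta> 1")
    case True
    then show thesis using that[of 1] by simp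
  next
    case False
    then show thesis using turns that[of "3 / 2"] by simp
  qed
  have sub: "{x..x + 1 / 2} \<subseteq> {1..2}" using x by auto
  have "\<exists>n::int. \<Theta> x \<le> 2 * pi * n + s \<and> 2 * pi * n + s \<le> \<Theta> x + 2 * pi" for s
  proof
    define y where "y = (\<Theta> x - s) / (2 * pi)"
    have "\<Theta> x = 2 * pi * y + s" by (simp add: y_def)
    moreover have "2 * pi * y \<le> 2 * pi * \<lceil>y\<rceil>" "2 * pi * \<lceil>y\<rceil> \<le> 2 * pi * (y + 1)"
      by (intro mult_left_mono; simp)+
    ultimately show "\<Theta> x \<le> 2 * pi * \<lceil>y\<rceil> + s \<and> 2 * pi * \<lceil>y\<rceil> + s \<le> \<Theta> x + 2 * pi"
      by (simp add: algebra_simps)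
  qed
  from this[of 0] this[of pi] obtain n k :: int
    where n: "\<Theta> x \<le> 2 * pi * n" "2 * pi * n \<le> \<Theta> x + 2 * pi"
      and k: "\<Theta> x \<le> 2 * pi * k + pi" "2 * pi * k + pi \<le> \<Theta> x + 2 * pi"
    by auto
  have "\<exists>r\<in>{x..x + 1 / 2}. \<Theta> r = y" if "\<Theta> x \<le> y" "y \<le> \<Theta> x + 2 * pi" for y
    using IVT'[of \<Theta> x y "x + 1 / 2"] that x continuous_on_subset[OF cont sub] by auto
  then obtain r1 r2 where r1: "r1 \<in> {x..x + 1 / 2}" "\<Theta> r1 = 2 * pi * of_int n"
    and r2: "r2 \<in> {x..x + 1 / 2}" "\<Theta> r2 = 2 * pi * of_int k + pi"
    using n k by meson
  have cos: "cos (\<Theta> r1) = 1" "cos (\<Theta> r2) = - 1"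
    by (simp_all add: r1 r2 cos_add)
  have r12: "r1 \<in> {1..2}" "r2 \<in> {1..2}" using r1(1) r2(1) sub by auto
  have gap: "1 / 4 \<le> \<omega> (r1 *\<^sub>R inner_circle 0) - \<omega> (r2 *\<^sub>R inner_circle 0)"
    using close[OF r12(1), unfolded cos] close[OF r12(2), unfolded cos] by linarith
  obtain z where z: "z \<in> {1..2}" "\<omega> (r1 *\<^sub>R inner_circle 0) - \<omega> (r2 *\<^sub>R inner_circle 0) =
      (r1 - r2) * (grad \<omega> (z *\<^sub>R inner_circle 0) \<bullet> inner_circle 0)"
    by (rule mvt_between[of "{1..2}" r2 r1 "\<lambda>r. \<omega> (r *\<^sub>R inner_circle 0)"
          "\<lambda>z. grad \<omega> (z *\<^sub>R inner_circle 0) \<bullet> inner_circle 0"])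
      (use r12 polar_has_derivative_radius[OF \<omega>] in auto)
  have "\<bar>r1 - r2\<bar> \<le> 1 / 2"
    using r1(1) r2(1) unfolding atLeastAtMost_iff abs_le_iff by linarith
  moreover have "\<bar>grad \<omega> (z *\<^sub>R inner_circle 0) \<bullet> inner_circle 0\<bar> \<le> C1_norm \<omega>"
    using Cauchy_Schwarz_ineq2[of "grad \<omega> (z *\<^sub>R inner_circle 0)" "inner_circle 0"]
      C1_norm_bounds(2)[OF \<omega> polar_in_annulus[OF z(1)]] by (fastforce intro: order_trans)
  ultimately have "\<bar>r1 - r2\<bar> * \<bar>grad \<omega> (z *\<^sub>R inner_circle 0) \<bullet> inner_circle 0\<bar> \<le> 1 / 2 * C1_norm \<omega>"
    by (intro mult_mono) auto
  then show ?thesis using gap z(2) by (simp add: abs_mult[symmetric])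
qed

section \<open>The angular profile\<close>

lemma norm_polar_decomp:
  fixes x :: "real^2"
  obtains \<theta> where "x = norm x *\<^sub>R inner_circle \<theta>"
proof (cases "x = 0")
  case False
  then have "(x $ 1 / norm x)\<^sup>2 + (x $ 2 / norm x)\<^sup>2 = 1"
    using power2_norm_eq_inner[of x] norm_eq_zero[of x]
    by (simp add: power_divide inner_real2 power2_eq_square[symmetric] del: norm_eq_zero flip: add_divide_distrib) auto
  then obtain \<theta> where "x $ 1 / norm x = cos \<theta>" "x $ 2 / norm x = sin \<theta>"
    using sincos_total_2pi by metis
  then have "norm x * cos \<theta> = x $ 1" "norm x * sin \<theta> = x $ 2"
    using False by (metis mult.commute nonzero_divide_eq_eq norm_eq_zero)+
  then have "x = norm x *\<^sub>R inner_circle \<theta>"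
    by (simp only: vec_eq_iff forall_2 vector_scaleR_component inner_circle_nth real_scaleR_def simp_thms)
  then show thesis by (rule that)
qed simp

text \<open>This is c + cos \<theta> / 2, written as a quotient to avoid choosing an angle; the only
  singularity, the origin, lies outside the annulus.\<close>

lemma cos_angle_C1: "(\<lambda>x. c + x $ 1 / (2 * norm x)) \<in> C1_annulus"
proof (rule C1_annulusI)
  show "((\<lambda>x. c + x $ 1 / (2 * norm x)) has_derivative
      (\<lambda>v. ((1 / (2 * norm x)) *\<^sub>R axis 1 1 - (x $ 1 / (2 * norm x ^ 3)) *\<^sub>R x) \<bullet> v)) (at x within annulus)"
    if "x \<in> annulus" for x :: "real^2"
  proof -
    have "x \<noteq> 0" using that by (auto simp: annulus_def)
    then show ?thesis
      by (auto intro!: derivative_eq_intros has_derivative_at_withinI[OF has_derivative_norm] bounded_linear.has_derivative[OF bounded_linear_vec_nth]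
          simp: inner_diff_left inner_diff_right inner_axis inner_axis' sgn_div_norm fun_eq_iff field_simps power3_eq_cube inner_commute)
  qed
  show "continuous_on annulus (\<lambda>x. (1 / (2 * norm x)) *\<^sub>R axis 1 1 - (x $ 1 / (2 * norm x ^ 3)) *\<^sub>R x :: real^2)"
    by (intro continuous_intros) (auto simp: annulus_def)
qed

lemma inner_polar: "x \<bullet> y = (x \<bullet> inner_circle \<theta>) * (y \<bullet> inner_circle \<theta>) + (x \<bullet> tangent \<theta>) * (y \<bullet> tangent \<theta>)"
proof -
  have "(x \<bullet> inner_circle \<theta>) * (y \<bullet> inner_circle \<theta>) + (x \<bullet> tangent \<theta>) * (y \<bullet> tangent \<theta>) =
    (x \<bullet> y) * ((sin \<theta>)\<^sup>2 + (cos \<theta>)\<^sup>2)"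
    unfolding inner_real2 inner_circle_nth tangent_nth by algebra
  then show ?thesis by simp
qed

section \<open>Transport of the vorticity by Euler solutions\<close>

lemma euler_annulus_field:
  assumes "euler_solution \<sigma> \<omega>0 \<omega> u"
  shows "annulus_field (u t)"
  using assms by unfold_locales (auto simp: euler_solution_def C1_curve_def)

lemma bounded_on_time_interval:
  fixes F :: "real \<Rightarrow> real^2 \<Rightarrow> 'a::real_normed_vector"
  assumes "continuous_on (UNIV \<times> annulus) (\<lambda>(t, x). F t x)"
  obtains B where "\<And>\<tau> x. \<tau> \<in> {0..t} \<Longrightarrow> x \<in> annulus \<Longrightarrow> norm (F \<tau> x) \<le> B"
proof -
  have "compact ((\<lambda>(t, x). F t x) ` ({0..t} \<times> annulus))"
    by (intro compact_continuous_image compact_Times compact_Icc compact_annulus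
        continuous_on_subset[OF assms]) auto
  then obtain B where "\<And>y. y \<in> (\<lambda>(t, x). F t x) ` ({0..t} \<times> annulus) \<Longrightarrow> norm y \<le> B"
    using compact_imp_bounded bounded_iff by metis
  then show thesis by (intro that[of B]) force
qed

text \<open>The bound may depend on the solution and on t: it merely supplies the constant C of the
  Euler steps. The part about Ur turns the vanishing of U on the circles into a bound by the
  distance to them.\<close>

lemma euler_velocity_bounds:
  assumes sol: "euler_solution \<sigma> \<omega>0 \<omega> u"
  obtains B where "\<And>\<tau> x. \<tau> \<in> {0..t} \<Longrightarrow> x \<in> annulus \<Longrightarrow> norm (u \<tau> x) \<le> B"
    "\<And>\<tau> r \<theta>. \<tau> \<in> {0..t} \<Longrightarrow> r \<in> {1..2} \<Longrightarrow> \<bar>annulus_field.Ur (u \<tau>) r \<theta>\<bar> \<le> B"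
proof -
  have cont: "continuous_on (UNIV \<times> annulus) (\<lambda>(t, x). u t x $ i)"
    "continuous_on (UNIV \<times> annulus) (\<lambda>(t, x). grad (\<lambda>x. u t x $ i) x)" for i
    using sol by (simp_all add: euler_solution_def C1_curve_def)
  have "\<exists>B. \<forall>\<tau>\<in>{0..t}. \<forall>x\<in>annulus. norm (u \<tau> x $ i) \<le> B" for i
    by (rule bounded_on_time_interval[OF cont(1)[of i], of t]) blast
  then obtain B where B: "\<And>i \<tau> x. \<tau> \<in> {0..t} \<Longrightarrow> x \<in> annulus \<Longrightarrow> \<bar>u \<tau> x $ i\<bar> \<le> B i"
    by (metis real_norm_def)
  have "\<exists>B. \<forall>\<tau>\<in>{0..t}. \<forall>x\<in>annulus. norm (grad (\<lambda>x. u \<tau> x $ i) x) \<le> B" for i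
    by (rule bounded_on_time_interval[OF cont(2)[of i], of t]) blast
  then obtain B' where B': "\<And>i \<tau> x. \<tau> \<in> {0..t} \<Longrightarrow> x \<in> annulus \<Longrightarrow> norm (grad (\<lambda>x. u \<tau> x $ i) x) \<le> B' i"
    by metis
  show thesis
  proof (rule that[of "max (B 1 + B 2) (B' 1 + B' 2)"])
    show "norm (u \<tau> x) \<le> max (B 1 + B 2) (B' 1 + B' 2)" if "\<tau> \<in> {0..t}" "x \<in> annulus" for \<tau> x
      using norm_le_l1_cart[of "u \<tau> x"] B[OF that, of 1] B[OF that, of 2] by (simp add: sum_2)
    show "\<bar>annulus_field.Ur (u \<tau>) r \<theta>\<bar> \<le> max (B 1 + B 2) (B' 1 + B' 2)"
      if \<tau>: "\<tau> \<in> {0..t}" and r: "r \<in> {1..2}" for \<tau> r \<theta>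
    proof -
      interpret annulus_field "u \<tau>" by (rule euler_annulus_field[OF sol])
      have *: "\<bar>(G i r \<theta> \<bullet> inner_circle \<theta>) * y\<bar> \<le> B' i" if "\<bar>y\<bar> \<le> 1" for i y
      proof -
        have "\<bar>G i r \<theta> \<bullet> inner_circle \<theta>\<bar> \<le> norm (G i r \<theta>)"
          using Cauchy_Schwarz_ineq2[of "G i r \<theta>" "inner_circle \<theta>"] by simp
        then have "\<bar>G i r \<theta> \<bullet> inner_circle \<theta>\<bar> * \<bar>y\<bar> \<le> norm (G i r \<theta>) * 1"
          using that by (intro mult_mono) auto
        then show ?thesis
          using B'[OF \<tau> polar_in_annulus[OF r, of \<theta>], of i] by (simp add: G_def abs_mult)
      qed
      show ?thesis
        using *[of "cos \<theta>" 1] *[of "sin \<theta>" 2] by (simp add: Ur_def)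
    qed
  qed
qed

lemma continuous_on_polar_curve:
  fixes F :: "real \<Rightarrow> real^2 \<Rightarrow> 'a::topological_space"
  assumes "continuous_on (UNIV \<times> annulus) (\<lambda>(t, x). F t x)"
  shows "continuous_on ({0..t} \<times> {1..2} \<times> UNIV)
    (\<lambda>x. F (fst x) (fst (snd x) *\<^sub>R inner_circle (snd (snd x))))"
proof -
  have "continuous_on ({0..t} \<times> {1..2} \<times> UNIV)
      (\<lambda>x. (\<lambda>(t, x). F t x) (fst x, fst (snd x) *\<^sub>R inner_circle (snd (snd x))))"
    by (rule continuous_on_compose2[OF assms]) (intro continuous_intros, auto)
  then show ?thesis by simp
qed

text \<open>In polar coordinates the transport term is U \<omega>_r + (V / r) \<omega>_\<theta>.
  Hence the coefficients are the radial velocity \<open>a\<close> and the angular velocity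
  \<open>b\<close>, with \<open>p\<close> and \<open>q\<close> the polar derivatives of \<omega>;
  the factor 1/2 in the outer bound is 1 / r at r = 2.\<close>

lemma euler_characteristics:
  assumes sol: "euler_solution \<sigma> \<omega>0 \<omega> u" and t: "0 < t" and \<eta>: "0 < \<eta>"
    and m1: "\<And>\<tau> \<theta>. \<tau> \<in> {0..t} \<Longrightarrow> m1 \<le> annulus_field.V (u \<tau>) 1 \<theta>"
    and m2: "\<And>\<tau> \<theta>. \<tau> \<in> {0..t} \<Longrightarrow> annulus_field.V (u \<tau>) 2 \<theta> / 2 \<le> m2"
  obtains R \<Theta> where "continuous_on {1..2} \<Theta>"
    "\<And>r. r \<in> {1..2} \<Longrightarrow> R r \<in> {1..2}"
    "\<And>r. r \<in> {1..2} \<Longrightarrow> \<bar>\<omega> 0 (R r *\<^sub>R inner_circle (\<Theta> r)) - \<omega> t (r *\<^sub>R inner_circle \<theta>0)\<bar> \<le> \<eta>"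
    "\<Theta> 1 \<le> \<theta>0 - t * m1" "\<theta>0 - t * m2 \<le> \<Theta> 2"
proof -
  interpret A: annulus_field "u t'" for t' by (rule euler_annulus_field[OF sol])
  have \<omega>: "\<omega> \<tau> \<in> C1_annulus" for \<tau> using sol by (simp add: euler_solution_def C1_curve_def)
  obtain B where B: "\<And>\<tau> x. \<tau> \<in> {0..t} \<Longrightarrow> x \<in> annulus \<Longrightarrow> norm (u \<tau> x) \<le> B"
    and Ur: "\<And>\<tau> r \<theta>. \<tau> \<in> {0..t} \<Longrightarrow> r \<in> {1..2} \<Longrightarrow> \<bar>A.Ur \<tau> r \<theta>\<bar> \<le> B"
    using euler_velocity_bounds[OF sol, of t] by blast
  define g where "g x = \<omega> (fst x) (fst (snd x) *\<^sub>R inner_circle (snd (snd x)))"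
    for x :: "real \<times> real \<times> real"
  define a where "a x = A.U (fst x) (fst (snd x)) (snd (snd x))" for x :: "real \<times> real \<times> real"
  define b where "b x = A.V (fst x) (fst (snd x)) (snd (snd x)) / fst (snd x)"
    for x :: "real \<times> real \<times> real"
  define p where "p x = grad (\<omega> (fst x)) (fst (snd x) *\<^sub>R inner_circle (snd (snd x))) \<bullet> inner_circle (snd (snd x))"
    for x :: "real \<times> real \<times> real"
  define q where "q x = fst (snd x) *
      (grad (\<omega> (fst x)) (fst (snd x) *\<^sub>R inner_circle (snd (snd x))) \<bullet> tangent (snd (snd x)))"
    for x :: "real \<times> real \<times> real"
  have cont_grad: "continuous_on (UNIV \<times> annulus) (\<lambda>(t, x). grad (\<omega> t) x)"
    and cont_u: "continuous_on (UNIV \<times> annulus) (\<lambda>(t, x). u t x $ i)" for i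
    using sol by (simp_all add: euler_solution_def C1_curve_def)
  note cont = continuous_on_polar_curve[OF cont_grad] continuous_on_polar_curve[OF cont_u]
  have U_bound: "\<bar>A.U \<tau> r \<theta> - A.U \<tau> r' \<theta>\<bar> \<le> B * \<bar>r - r'\<bar>"
    if "\<tau> \<in> {0..t}" "r \<in> {1..2}" "r' \<in> {1..2}" for \<tau> r r' \<theta>
    using field_differentiable_bound[of "{1..2}" "\<lambda>r. A.U \<tau> r \<theta>" "\<lambda>r. A.Ur \<tau> r \<theta>" B r' r]
      A.has_derivative_radius(1) Ur[OF that(1)] that by (auto simp: abs_minus_commute)
  show thesis
  proof (rule backward_characteristics[OF t \<eta>, of a b p q g B m1 m2 \<theta>0])
    show "continuous_on ({0..t} \<times> {1..2} \<times> UNIV) a" "continuous_on ({0..t} \<times> {1..2} \<times> UNIV) b"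
      "continuous_on ({0..t} \<times> {1..2} \<times> UNIV) p" "continuous_on ({0..t} \<times> {1..2} \<times> UNIV) q"
      unfolding a_def b_def p_def q_def A.UV_eq
      by (intro continuous_intros continuous_on_cos continuous_on_sin cont; auto)+
    fix \<tau> r \<theta> :: real assume \<tau>: "\<tau> \<in> {0..t}" and r: "r \<in> {1..2}"
    let ?x = "r *\<^sub>R inner_circle \<theta>"
    have "((\<lambda>s. \<omega> s ?x) has_real_derivative - (u \<tau> ?x \<bullet> grad (\<omega> \<tau>) ?x)) (at \<tau>)"
      using sol polar_in_annulus[OF r] unfolding euler_solution_def by blast
    moreover have "u \<tau> ?x \<bullet> grad (\<omega> \<tau>) ?x = a (\<tau>, r, \<theta>) * p (\<tau>, r, \<theta>) + b (\<tau>, r, \<theta>) * q (\<tau>, r, \<theta>)"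
      unfolding inner_polar[of "u \<tau> ?x" "grad (\<omega> \<tau>) ?x" \<theta>]
      using r by (simp add: a_def b_def p_def q_def A.U_def A.V_def)
    ultimately show "((\<lambda>\<tau>. g (\<tau>, r, \<theta>)) has_real_derivative
        - (a (\<tau>, r, \<theta>) * p (\<tau>, r, \<theta>) + b (\<tau>, r, \<theta>) * q (\<tau>, r, \<theta>))) (at \<tau>)"
      by (simp add: g_def)
    show "((\<lambda>r. g (\<tau>, r, \<theta>)) has_real_derivative p (\<tau>, r, \<theta>)) (at r within {1..2})"
      using polar_has_derivative_radius[OF \<omega> r] by (simp add: g_def p_def)
    show "((\<lambda>\<theta>. g (\<tau>, r, \<theta>)) has_real_derivative q (\<tau>, r, \<theta>)) (at \<theta>)"
      using polar_has_derivative_angle[OF \<omega> r] by (simp add: g_def q_def)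
    show "\<bar>a (\<tau>, r, \<theta>)\<bar> \<le> B * (r - 1)" "\<bar>a (\<tau>, r, \<theta>)\<bar> \<le> B * (2 - r)"
      using U_bound[OF \<tau> r, of 1 \<theta>] U_bound[OF \<tau> r, of 2 \<theta>] r
      by (simp_all add: a_def A.U_boundary)
    have "\<bar>A.V \<tau> r \<theta>\<bar> \<le> B"
      using Cauchy_Schwarz_ineq2[of "u \<tau> ?x" "tangent \<theta>"] B[OF \<tau> polar_in_annulus[OF r, of \<theta>]]
      by (simp add: A.V_def)
    moreover have "\<bar>A.V \<tau> r \<theta>\<bar> / r \<le> \<bar>A.V \<tau> r \<theta>\<bar> / 1"
      using r by (intro divide_left_mono) auto
    ultimately show "\<bar>b (\<tau>, r, \<theta>)\<bar> \<le> B" using r by (simp add: b_def)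
  next
    show "m1 \<le> b (\<tau>, 1, \<theta>)" "b (\<tau>, 2, \<theta>) \<le> m2" if "\<tau> \<in> {0..t}" for \<tau> \<theta>
      using m1[OF that] m2[OF that] by (simp_all add: b_def)
  next
    fix R \<Theta>
    assume "continuous_on {1..2} \<Theta>" "\<And>r. r \<in> {1..2} \<Longrightarrow> R r \<in> {1..2}"
      "\<And>r. r \<in> {1..2} \<Longrightarrow> \<bar>g (0, R r, \<Theta> r) - g (t, r, \<theta>0)\<bar> \<le> \<eta>"
      "\<Theta> 1 \<le> \<theta>0 - t * m1" "\<theta>0 - t * m2 \<le> \<Theta> 2"
    then show thesis using that[of \<Theta> R] by (simp add: g_def)
  qed
qed

text \<open>Every value at time t is nearly an initial value somewhere in the annulus; the gap
  between M and M' absorbs the error of the approximate characteristics. Crude angular bounds -B and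
  B serve here, which avoids circularity, as the sharp ones rest on this lemma.\<close>

lemma vorticity_bound_propagates:
  assumes sol: "euler_solution \<sigma> \<omega>0 \<omega> u" and "0 \<le> t" "x \<in> annulus"
    and bound: "\<And>x. x \<in> annulus \<Longrightarrow> \<bar>\<omega>0 x - c\<bar> \<le> M" and "M < M'"
  shows "\<bar>\<omega> t x - c\<bar> < M'"
proof -
  have init: "\<omega> 0 y = \<omega>0 y" if "y \<in> annulus" for y
    using sol that unfolding euler_solution_def by blast
  interpret A: annulus_field "u t'" for t' by (rule euler_annulus_field[OF sol])
  show ?thesis
  proof (cases "t = 0")
    case True
    then show ?thesis using bound[OF \<open>x \<in> annulus\<close>] init[OF \<open>x \<in> annulus\<close>] \<open>M < M'\<close> by simp
  next
    case False
    with \<open>0 \<le> t\<close> have t: "0 < t" by simp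
    obtain B where B: "\<And>\<tau> x. \<tau> \<in> {0..t} \<Longrightarrow> x \<in> annulus \<Longrightarrow> norm (u \<tau> x) \<le> B"
      and "\<And>\<tau> r \<theta>. \<tau> \<in> {0..t} \<Longrightarrow> r \<in> {1..2} \<Longrightarrow> \<bar>A.Ur \<tau> r \<theta>\<bar> \<le> B"
      using euler_velocity_bounds[OF sol, of t] by blast
    have V: "\<bar>A.V \<tau> r \<theta>\<bar> \<le> B" if "\<tau> \<in> {0..t}" "r \<in> {1..2}" for \<tau> r \<theta>
      using Cauchy_Schwarz_ineq2[of "u \<tau> (r *\<^sub>R inner_circle \<theta>)" "tangent \<theta>"]
        B[OF that(1) polar_in_annulus[OF that(2), of \<theta>]] by (simp add: A.V_def)
    obtain \<theta>0 where \<theta>0: "x = norm x *\<^sub>R inner_circle \<theta>0" by (rule norm_polar_decomp)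
    have x: "norm x \<in> {1..2}" using \<open>x \<in> annulus\<close> by (simp add: annulus_def)
    obtain R \<Theta> where R: "\<And>r. r \<in> {1..2} \<Longrightarrow> R r \<in> {1..2}" and
      close: "\<And>r. r \<in> {1..2} \<Longrightarrow>
        \<bar>\<omega> 0 (R r *\<^sub>R inner_circle (\<Theta> r)) - \<omega> t (r *\<^sub>R inner_circle \<theta>0)\<bar> \<le> (M' - M) / 2"
    proof (rule euler_characteristics[OF sol t, of "(M' - M) / 2" "- B" B \<theta>0])
      show "- B \<le> A.V \<tau> 1 \<theta>" "A.V \<tau> 2 \<theta> / 2 \<le> B" if "\<tau> \<in> {0..t}" for \<tau> \<theta>
        using V[OF that, of 1 \<theta>] V[OF that, of 2 \<theta>] by auto
      show "0 < (M' - M) / 2" using \<open>M < M'\<close> by simp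
      fix R \<Theta>
      assume "\<And>r. r \<in> {1..2} \<Longrightarrow> R r \<in> {1..2}"
        "\<And>r. r \<in> {1..2} \<Longrightarrow>
          \<bar>\<omega> 0 (R r *\<^sub>R inner_circle (\<Theta> r)) - \<omega> t (r *\<^sub>R inner_circle \<theta>0)\<bar> \<le> (M' - M) / 2"
      then show thesis by (rule that)
    qed
    have "R (norm x) *\<^sub>R inner_circle (\<Theta> (norm x)) \<in> annulus" by (rule polar_in_annulus[OF R[OF x]])
    from bound[OF this] close[OF x, folded \<theta>0, unfolded init[OF this]] \<open>M < M'\<close> show ?thesis
      unfolding abs_le_iff abs_less_iff by (simp add: field_simps)
  qed
qed

section \<open>Choice of the profile and of the constants\<close>

theorem theorem3p1:
  fixes \<sigma>1 :: real
  shows "\<exists>\<xi>\<in>C1_annulus. \<exists>\<epsilon>>0. \<exists>T>0.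
           \<forall>\<omega>0\<in>C1_annulus. C1_norm (\<lambda>x. \<omega>0 x - \<xi> x) < \<epsilon> \<longrightarrow>
             (\<forall>\<omega> u. euler_solution \<sigma>1 \<omega>0 \<omega> u \<longrightarrow>
                (\<forall>t>T. C1_norm (\<lambda>x. \<omega> t x - \<xi> x) > \<epsilon>))"
proof -
  define s where "s = \<sigma>1 / (2 * pi)"
  \<comment> \<open>The steady flow with vorticity c then has angular velocity s on the inner and 3
    c / 8 + s / 4 = s - 3 on the outer circle. A deviation d = 1 costs 5/4 and 3/8, which leaves a
    gap of 11/8; as this exceeds 1, the time 4 pi is enough for two turns.\<close>
  define c where "c = 2 * s - 8"
  define \<xi> :: "real^2 \<Rightarrow> real" where "\<xi> x = c + x $ 1 / (2 * norm x)" for x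
  have \<xi>: "\<xi> \<in> C1_annulus" unfolding \<xi>_def by (rule cos_angle_C1)
  have \<xi>_polar: "\<xi> (r *\<^sub>R inner_circle \<theta>) = c + cos \<theta> / 2" if "r \<in> {1..2}" for r \<theta>
    using that by (simp add: \<xi>_def)
  have main: "1 / 4 < C1_norm (\<lambda>x. \<omega> t x - \<xi> x)"
    if \<omega>0: "\<omega>0 \<in> C1_annulus" "C1_norm (\<lambda>x. \<omega>0 x - \<xi> x) < 1 / 4"
      and sol: "euler_solution \<sigma>1 \<omega>0 \<omega> u" and t: "4 * pi < t" for \<omega>0 \<omega> u t
  proof -
    interpret A: annulus_field "u t'" for t' by (rule euler_annulus_field[OF sol])
    have near: "\<bar>\<omega>0 x - \<xi> x\<bar> < 1 / 4" if "x \<in> annulus" for x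
      using C1_norm_bounds(1)[OF C1_annulus_diff[OF \<omega>0(1) \<xi>] that] \<omega>0(2) by simp
    \<comment> \<open>Amplitude 1/2 of the profile plus perturbation 1/4; the room up to 1 is used
      by the propagation.\<close>
    have "\<bar>\<omega>0 x - c\<bar> \<le> 3 / 4" if "x \<in> annulus" for x
    proof -
      obtain \<theta> where "x = norm x *\<^sub>R inner_circle \<theta>" by (rule norm_polar_decomp)
      then have \<xi>_eq: "\<xi> x = c + cos \<theta> / 2"
        using \<xi>_polar[of "norm x" \<theta>] that by (simp add: annulus_def)
      then show ?thesis
        using near[OF that, unfolded \<xi>_eq] cos_le_one[of \<theta>] cos_ge_minus_one[of \<theta>] by linarith
    qed
    then have "\<bar>\<omega> \<tau> x - c\<bar> < 1" if "0 \<le> \<tau>" "x \<in> annulus" for \<tau> x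
      using vorticity_bound_propagates[OF sol that, of c "3 / 4" 1] by simp
    then have curl: "\<bar>curl (u \<tau>) x - c\<bar> < 1" if "0 \<le> \<tau>" "x \<in> annulus" for \<tau> x
      using sol that by (simp add: euler_solution_def)
    have circ: "inner_circulation (u \<tau>) / (2 * pi) = s" for \<tau>
      using sol by (simp add: euler_solution_def s_def)
    have t0: "0 < t" using t pi_gt_zero by linarith
    \<comment> \<open>The tolerance 1/8 and the initial perturbation 1/4 add up to the 3/8 allowed
      in \<open>oscillation_gives_gradient\<close>.\<close>
    obtain R \<Theta> where cont: "continuous_on {1..2} \<Theta>"
      and R: "\<And>r. r \<in> {1..2} \<Longrightarrow> R r \<in> {1..2}"
      and close: "\<And>r. r \<in> {1..2} \<Longrightarrow>
        \<bar>\<omega> 0 (R r *\<^sub>R inner_circle (\<Theta> r)) - \<omega> t (r *\<^sub>R inner_circle 0)\<bar> \<le> 1 / 8"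
      and ends: "\<Theta> 1 \<le> 0 - t * (s - 5 / 4)" "0 - t * (s - 21 / 8) \<le> \<Theta> 2"
    proof (rule euler_characteristics[OF sol t0, of "1 / 8" "s - 5 / 4" "s - 21 / 8" 0])
      fix \<tau> \<theta> assume "\<tau> \<in> {0..t}"
      then have "\<bar>curl (u \<tau>) x - c\<bar> < 1" if "x \<in> annulus" for x
        using curl[of \<tau>] that by simp
      note * = A.boundary_velocity[of \<tau> c 1 \<theta>, OF this, unfolded circ]
      show "s - 5 / 4 \<le> A.V \<tau> 1 \<theta>" using *(1) by simp
      have "3 / 8 * c + s / 4 + 3 / 8 * 1 = s - 21 / 8" by (simp add: c_def field_simps)
      with *(2) show "A.V \<tau> 2 \<theta> / 2 \<le> s - 21 / 8" by metis
    next
      fix R \<Theta>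
      assume "continuous_on {1..2} \<Theta>" "\<And>r. r \<in> {1..2} \<Longrightarrow> R r \<in> {1..2}"
        "\<And>r. r \<in> {1..2} \<Longrightarrow>
          \<bar>\<omega> 0 (R r *\<^sub>R inner_circle (\<Theta> r)) - \<omega> t (r *\<^sub>R inner_circle 0)\<bar> \<le> 1 / 8"
        "\<Theta> 1 \<le> 0 - t * (s - 5 / 4)" "0 - t * (s - 21 / 8) \<le> \<Theta> 2"
      then show thesis by (rule that)
    qed simp
    have "4 * pi \<le> \<Theta> 2 - \<Theta> 1"
      using ends t t0 by (simp add: algebra_simps)
    \<comment> \<open>On the ray of angle 0 the profile is the constant c + 1/2, so subtracting it
      only replaces the offset c by -1/2, and the oscillation argument applies to the difference
      itself.\<close>
    moreover have "\<bar>(\<omega> t (r *\<^sub>R inner_circle 0) - \<xi> (r *\<^sub>R inner_circle 0)) -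
        (- 1 / 2 + cos (\<Theta> r) / 2)\<bar> \<le> 3 / 8" if r: "r \<in> {1..2}" for r
    proof -
      let ?y = "R r *\<^sub>R inner_circle (\<Theta> r)"
      have y: "?y \<in> annulus" by (rule polar_in_annulus[OF R[OF r]])
      have "\<omega> 0 ?y = \<omega>0 ?y" using sol y unfolding euler_solution_def by blast
      then have "\<bar>\<omega>0 ?y - \<omega> t (r *\<^sub>R inner_circle 0)\<bar> \<le> 1 / 8" using close[OF r] by simp
      then show ?thesis
        using near[OF y] \<xi>_polar[OF R[OF r], of "\<Theta> r"] \<xi>_polar[OF r, of 0, unfolded cos_zero] by linarith
    qed
    moreover have "(\<lambda>x. \<omega> t x - \<xi> x) \<in> C1_annulus"
      using sol \<xi> by (intro C1_annulus_diff) (auto simp: euler_solution_def C1_curve_def)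
    ultimately have "1 / 2 \<le> C1_norm (\<lambda>x. \<omega> t x - \<xi> x)"
      using cont by (intro oscillation_gives_gradient[where c = "- 1 / 2" and \<Theta> = \<Theta>]) auto
    then show ?thesis by simp
  qed
  show ?thesis
    by (intro bexI[OF _ \<xi>] exI[of _ "1 / 4"] exI[of _ "4 * pi"] conjI ballI allI impI)
      (simp, simp, erule (3) main)
qed

end
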